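(* Let $X\in\{F,L\}$, with $a_j^X,\ t_{N,j}^X,\ p_{N,j}^X,\ p_j^X,\ D_X$ as defined in the context (Fibonacci case $X=F$, Lucas case $X=L$). Then: (i) The limiting distribution $(p_j^X)_{j\ge 2,\ j\text{ even}}$ has its unique maximum at $j=8$. (ii) For every even integer $N\ge 26$, the unique largest term magnitude among $|t_{N,j}^X|$, $1\le j\le N-2$, also occurs at $j=8$. (iii) As $N$ tends to infinity through even integers, $$\max_{1\le j\le N-2}|t_{N,j}^X|\sim \frac{a_8^X\pi^8}{8!}\,\frac{N!}{\pi^N},\qquad p_{N,8}^X\to\frac{a_8^X\pi^8}{8!\,D_X}.$$ The limiting shares $\frac{a_8^X\pi^8}{8!\,D_X}$ are approximately $0.273209$ for the Fibonacci weights ($X=F$) and $0.284964$ for the Lucas weights ($X=L$). The threshold $26$ is sufficient, and no assertion is made that it is minimal.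
   Context: $\zeta$ denotes the Riemann zeta function (meromorphically continued). The Fibonacci and Lucas numbers are $F_0=0$, $F_1=1$, $L_0=2$, $L_1=1$, with $F_{j+2}=F_{j+1}+F_j$ and $L_{j+2}=L_{j+1}+L_j$. The weights are $$a_j^F=F_j+F_{2j},\qquad a_j^L=L_{2j}-L_j\qquad(j\ge 0).$$ For $X\in\{F,L\}$ set $$E_X(t)=\sum_{j\ge 2,\ j\text{ even}}a_j^X\frac{t^j}{j!},\qquad D_X=E_X(\pi),\qquad p_j^X=\frac{a_j^X\pi^j}{j!\,D_X}\ (j\ge 2\text{ even}).$$ For an even integer $N\ge 4$ set $$t_{N,j}^X=N\binom{N-1}{j}a_j^X\,2^{N-j-1}\zeta(j+1-N)\quad(1\le j\le N-2),\qquad M_N^X=\sum_{j=1}^{N-2}|t_{N,j}^X|,$$ and, for even $j$ with $2\le j\le N-2$, $p_{N,j}^X=|t_{N,j}^X|/M_N^X$ (extended by $p_{N,j}^X=0$ for even $j\ge N$). The notation $u_N\sim v_N$ means $u_N/v_N\to 1$. *)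

theory Defs
  imports
    "HOL-Complex_Analysis.Complex_Analysis"
    "HOL-Number_Theory.Fib"
    "HOL-Library.Landau_Symbols"
begin

(* The Dirichlet series fixes the function on Re s > 1, and analytic continuation fixes it
   everywhere else; nicely_meromorphic_on normalises the value to 0 at a pole (here s = 1)
   and excludes removable discontinuities, so the function described is unique. *)
definition zeta :: "complex \<Rightarrow> complex" where
  "zeta = (THE f. f nicely_meromorphic_on UNIV \<and>
             (\<forall>s. Re s > 1 \<longrightarrow> (\<lambda>n. 1 / of_nat (Suc n) powr s) sums f s))"

fun lucas :: "nat \<Rightarrow> nat" where
  "lucas 0 = 2"
| "lucas (Suc 0) = 1"
| "lucas (Suc (Suc n)) = lucas (Suc n) + lucas n"

datatype seq_kind = Fibonacci | Lucas

fun weight :: "seq_kind \<Rightarrow> nat \<Rightarrow> real" where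
  "weight Fibonacci j = real (fib j) + real (fib (2 * j))"
| "weight Lucas j = real (lucas (2 * j)) - real (lucas j)"

definition E_gf :: "seq_kind \<Rightarrow> real \<Rightarrow> real" where
  "E_gf X t = (\<Sum>\<^sub>\<infinity>j\<in>{j. even j \<and> 2 \<le> j}. weight X j * t ^ j / fact j)"

definition D_const :: "seq_kind \<Rightarrow> real" where
  "D_const X = E_gf X pi"

(* meaningful for even j with j >= 2 *)
definition p_lim :: "seq_kind \<Rightarrow> nat \<Rightarrow> real" where
  "p_lim X j = weight X j * pi ^ j / (fact j * D_const X)"

(* Meaningful for 1 <= j <= N - 2, where the natural-number subtractions are exact.
   The argument of zeta is a negative integer, so it is formed in int. *)
definition t_term :: "seq_kind \<Rightarrow> nat \<Rightarrow> nat \<Rightarrow> complex" where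
  "t_term X N j = of_nat N * of_nat ((N - 1) choose j) * of_real (weight X j) *
                  2 ^ (N - j - 1) * zeta (of_int (int j + 1 - int N))"

definition M_total :: "seq_kind \<Rightarrow> nat \<Rightarrow> real" where
  "M_total X N = (\<Sum>j=1..N-2. norm (t_term X N j))"

(* meaningful for even N >= 4 and even j >= 2 *)
definition p_fin :: "seq_kind \<Rightarrow> nat \<Rightarrow> nat \<Rightarrow> real" where
  "p_fin X N j = (if j \<le> N - 2 then norm (t_term X N j) / M_total X N else 0)"

abbreviation even_at_top :: "nat filter" where
  "even_at_top \<equiv> inf sequentially (principal {N. even N})"

end

(* Writing eta(s) for the alternating zeta series, zeta(s) = eta(s) / (1 - 2^(1-s)), and iterated
   Euler transformation continues eta to an entire function.  At s = -k the transformed series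
   terminates, and the values eta(-k) satisfy the binomial recursion of the Taylor coefficients of
   1/(exp(2 pi i z) + 1).  The reflection formula for Gamma expands that function in partial
   fractions, which gives zeta(-k) = 0 for even k > 0 and
   |zeta(-k)| = 2 k! zeta(k+1) / (2 pi)^(k+1) for odd k.  Consequently |t_{N,j}| vanishes for odd j
   and equals N!/pi^N * w_j * zeta(N-j) for even j, with w_j = a_j pi^j / j!.  Since zeta(n) lies
   between 1 and 1 + 3/2^n, the terms compare like w_j; the w_j rise up to j = 8 and then decay,
   by the growth bound a_{j+2} <= 8 a_j and pi^2 < 9.87. *)

theory Submission
  imports Defs
begin

section \<open>Finite differences and the entire function eta\<close>

text \<open>\<open>zeta\<close> is given only by a description, so an explicit candidate must be
  exhibited and identified. The zeros of 1 - 2^(1-s) other than s = 1 need no separate study: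
  \<open>remove_sings\<close> normalises all of them at once, and the identity theorem does the
  rest. The values at -k rest on the formal identity sum_j (-1)^j exp(j t) = 1 / (1 + exp t):
  regularised values of sum_j (-1)^j j^k should be the Taylor coefficients of the right-hand side in
  t. Euler's transformation makes this exact, since it terminates on polynomials; both sequences
  then obey x_n + sum_{i <= n} binom(n, i) x_i = 0^n, which determines them. With t = 2 pi i z the
  poles sit at the half-integers, so Digamma at 1/2 + z and 1/2 - z supplies the partial fractions,
  and Polygamma at 1/2 supplies zeta(k+1). For finite N the factor zeta(N-j) grows with j: it
  favours j = 8 over smaller j but works against it for larger j. The threshold 26 makes N - 10 at
  least 16, so zeta(N-10) hardly exceeds 1; from j = 12 on the decay of w_j outweighs even
  zeta(2).\<close>

definition fdiff :: "(nat \<Rightarrow> complex) \<Rightarrow> nat \<Rightarrow> complex" where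
  "fdiff b k = b k - b (Suc k)"

lemma fdiff_pow_shift: "(fdiff ^^ m) b (i + k) = (fdiff ^^ m) (\<lambda>j. b (i + j)) k"
  by (induction m arbitrary: k) (simp_all add: fdiff_def flip: add_Suc_right)

lemma fdiff_pow_cmult: "(fdiff ^^ m) (\<lambda>k. r * b k) k = r * (fdiff ^^ m) b k"
  by (induction m arbitrary: k) (simp_all add: fdiff_def algebra_simps)

lemma fdiff_pow_holomorphic:
  assumes "\<And>k. (\<lambda>s. b s k) holomorphic_on A"
  shows "(\<lambda>s. (fdiff ^^ m) (b s) k) holomorphic_on A"
  by (induction m arbitrary: k) (auto simp: fdiff_def intro!: holomorphic_intros assms)

lemma norm_diff_Suc_le:
  fixes g :: "real \<Rightarrow> complex"
  assumes "\<And>y. y \<ge> x \<Longrightarrow> (g has_vector_derivative g' y) (at y)"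
    and "\<And>y. y \<ge> x \<Longrightarrow> norm (g' y) \<le> B"
  shows "norm (g x - g (x + 1)) \<le> B"
proof -
  have "norm (g (x + 1) - g x) \<le> B * norm ((x + 1) - x)"
  proof (rule differentiable_bound[of "{x..x+1}" g "\<lambda>y h. h *\<^sub>R g' y"])
    fix y assume y: "y \<in> {x..x+1}"
    show "(g has_derivative (\<lambda>h. h *\<^sub>R g' y)) (at y within {x..x+1})"
      using assms(1)[of y] y has_derivative_at_withinI
      by (auto simp: has_vector_derivative_def)
    show "onorm (\<lambda>h. h *\<^sub>R g' y) \<le> B"
    proof (rule onorm_bound)
      show "0 \<le> B" using order_trans[OF norm_ge_zero assms(2)[of y]] y by auto
      show "norm (h *\<^sub>R g' y) \<le> B * norm h" for h
        using y assms(2)[of y] by (auto simp: mult.commute[of _ "\<bar>h\<bar>"] intro: mult_left_mono)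
    qed
  qed auto
  thus ?thesis by (simp add: norm_minus_commute)
qed

text \<open>Here \<open>g i\<close> is the \<open>i\<close>-th derivative of \<open>g 0\<close>. One
  difference replaces the whole family by g(x) - g(x+1), again a family of successive derivatives,
  and the mean value inequality shows that its \<open>m\<close>-th member inherits the bound on
  \<open>g (Suc m)\<close>.\<close>

lemma norm_fdiff_pow_le:
  fixes g :: "nat \<Rightarrow> real \<Rightarrow> complex"
  assumes "\<And>i x. x \<ge> c \<Longrightarrow> (g i has_vector_derivative g (Suc i) x) (at x)"
    and "\<And>x. x \<ge> c \<Longrightarrow> norm (g m x) \<le> B"
  shows "norm ((fdiff ^^ m) (\<lambda>k. g 0 (c + real k)) 0) \<le> B"
  using assms
proof (induction m arbitrary: g)
  case 0
  then show ?case by simp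
next
  case (Suc m)
  define h where "h = (\<lambda>i x. g i x - g i (x + 1))"
  have "norm ((fdiff ^^ m) (\<lambda>k. h 0 (c + real k)) 0) \<le> B"
  proof (rule Suc.IH)
    fix i x assume x: "x \<ge> c"
    have "((\<lambda>x. g i (x + 1)) has_vector_derivative g (Suc i) (x + 1)) (at x)"
      using Suc.prems(1)[of "x + 1" i] x
        vector_diff_chain_at[of "\<lambda>x. x + 1" 1 x "g i" "g (Suc i) (x + 1)"]
      by (auto simp: o_def has_vector_derivative_add_const)
    thus "(h i has_vector_derivative h (Suc i) x) (at x)"
      unfolding h_def using Suc.prems(1)[of x i] x by (auto intro!: derivative_intros)
  next
    fix x assume "x \<ge> c"
    thus "norm (h m x) \<le> B"
      unfolding h_def by (intro norm_diff_Suc_le[where g' = "g (Suc m)"]) (auto intro!: Suc.prems)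
  qed
  moreover have "fdiff (\<lambda>k. g 0 (c + real k)) = (\<lambda>k. h 0 (c + real k))"
    by (auto simp: fdiff_def h_def algebra_simps)
  ultimately show ?case by (simp add: funpow_Suc_right del: funpow.simps)
qed

text \<open>The \<open>m\<close>-th derivative of x^(-s) is the product times x^(-s-m). The
  hypothesis makes its norm nonincreasing, so it is largest at the left end
  \<open>Suc k\<close>.\<close>

lemma norm_fdiff_pow_powr_le:
  assumes "Re s + real m \<ge> 0"
  shows "norm ((fdiff ^^ m) (\<lambda>k. of_nat (Suc k) powr (-s)) k)
           \<le> norm (\<Prod>i<m. -s - of_nat i) * real (Suc k) powr (- Re s - real m)"
proof -
  define c where "c = real (Suc k)"
  have c: "c > 0" by (simp add: c_def)
  define g where "g = (\<lambda>i x. (\<Prod>l<i. -s - of_nat l) * of_real x powr (-s - of_nat i))"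
  have "norm ((fdiff ^^ m) (\<lambda>j. g 0 (c + real j)) 0)
          \<le> norm (\<Prod>i<m. -s - of_nat i) * c powr (- Re s - real m)"
  proof (rule norm_fdiff_pow_le)
    fix i x assume x: "x \<ge> c"
    with c have "complex_of_real x \<notin> \<real>\<^sub>\<le>\<^sub>0" by (auto simp: complex_nonpos_Reals_iff)
    hence "((\<lambda>z. (\<Prod>l<i. -s - of_nat l) * z powr (-s - of_nat i)) has_field_derivative g (Suc i) x)
             (at (of_real x))"
      by (auto simp: g_def algebra_simps intro!: derivative_eq_intros has_field_derivative_powr)
    from has_vector_derivative_real_field[OF this]
    show "(g i has_vector_derivative g (Suc i) x) (at x)"
      by (simp add: g_def)
  next
    fix x assume x: "x \<ge> c"
    have "x powr (- Re s - real m) \<le> c powr (- Re s - real m)"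
      using x c assms by (intro powr_mono2') auto
    thus "norm (g m x) \<le> norm (\<Prod>i<m. -s - of_nat i) * c powr (- Re s - real m)"
      using x c by (auto simp: g_def norm_mult norm_powr_real_powr intro!: mult_left_mono)
  qed
  moreover have "(fdiff ^^ m) (\<lambda>k. of_nat (Suc k) powr (-s)) k
                   = (fdiff ^^ m) (\<lambda>j. g 0 (c + real j)) 0"
    using fdiff_pow_shift[of m "\<lambda>k. of_nat (Suc k) powr (-s)" k 0]
    by (simp add: g_def c_def algebra_simps)
  ultimately show ?thesis by (simp add: c_def)
qed

lemma summable_Suc_powr: "a < -1 \<Longrightarrow> summable (\<lambda>k. real (Suc k) powr a)"
  using summable_Suc_iff[of "\<lambda>k. real k powr a"] by (simp add: summable_real_powr_iff)

lemma summable_fdiff_pow_powr: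
  assumes "Re s > 1 - real m"
  shows "summable (\<lambda>k. (-1) ^ k * (fdiff ^^ m) (\<lambda>k. of_nat (Suc k) powr (-s)) k)"
proof (rule summable_norm_cancel, rule summable_comparison_test')
  show "summable (\<lambda>k. norm (\<Prod>i<m. -s - of_nat i) * real (Suc k) powr (- Re s - real m))"
    using assms by (intro summable_mult summable_Suc_powr) auto
  show "norm (norm ((-1) ^ k * (fdiff ^^ m) (\<lambda>k. of_nat (Suc k) powr (-s)) k))
          \<le> norm (\<Prod>i<m. -s - of_nat i) * real (Suc k) powr (- Re s - real m)" for k
    using norm_fdiff_pow_powr_le[of s m k] assms by (simp add: norm_mult norm_power)
qed

text \<open>Euler's transformation, applied \<open>m\<close> times: the finite part is collected in \<open>euler_part\<close>, and the
  remaining series converges for \<open>Re s > 1 - m\<close> because \<open>m\<close>-th differences gain \<open>m\<close> powers.\<close>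
definition euler_part :: "nat \<Rightarrow> (nat \<Rightarrow> complex) \<Rightarrow> complex" where
  "euler_part m b = (\<Sum>n<m. (fdiff ^^ n) b 0 / 2 ^ Suc n)"

definition eta_level :: "nat \<Rightarrow> complex \<Rightarrow> complex" where
  "eta_level m s = euler_part m (\<lambda>k. of_nat (Suc k) powr (-s))
     + (\<Sum>k. (-1) ^ k * (fdiff ^^ m) (\<lambda>k. of_nat (Suc k) powr (-s)) k) / 2 ^ m"

text \<open>The chosen level exceeds 1 - Re s, which is what convergence of the remaining series
  requires; by \<open>eta_eq_level\<close> every such level gives the same value.\<close>

definition eta :: "complex \<Rightarrow> complex" where
  "eta s = eta_level (nat \<lceil>2 - Re s\<rceil>) s"

text \<open>One Euler step: adding the series S to its shifted copy S - b 0 produces the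
  differences.\<close>

lemma suminf_fdiff:
  assumes "summable (\<lambda>k. (-1) ^ k * b k)"
  shows "(\<Sum>k. (-1) ^ k * b k) = (b 0 + (\<Sum>k. (-1) ^ k * fdiff b k)) / 2"
proof -
  define S where "S = (\<Sum>k. (-1) ^ k * b k)"
  have S: "(\<lambda>k. (-1) ^ k * b k) sums S"
    using assms by (simp add: S_def summable_sums)
  hence "(\<lambda>k. (-1) ^ Suc k * b (Suc k)) sums (S - b 0)"
    using sums_Suc_iff[of "\<lambda>k. (-1) ^ k * b k" "S - b 0"] by simp
  from sums_add[OF S this] have "(\<lambda>k. (-1) ^ k * fdiff b k) sums (2 * S - b 0)"
    by (simp add: fdiff_def algebra_simps)
  thus ?thesis by (simp add: sums_iff S_def)
qed

lemma eta_level_mono: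
  assumes "Re s > 1 - real m" "m \<le> n"
  shows "eta_level n s = eta_level m s"
  using assms(2)
proof (induction rule: dec_induct)
  case (step n)
  have "summable (\<lambda>k. (-1) ^ k * (fdiff ^^ n) (\<lambda>k. of_nat (Suc k) powr (-s)) k)"
    using assms step by (intro summable_fdiff_pow_powr) auto
  from suminf_fdiff[OF this] have "eta_level (Suc n) s = eta_level n s"
    by (simp only: eta_level_def euler_part_def sum.lessThan_Suc funpow.simps o_apply)
       (simp add: add_divide_distrib)
  with step show ?case by simp
qed auto

lemma eta_eq_level:
  assumes "Re s > 1 - real m"
  shows "eta s = eta_level m s"
proof -
  have "Re s > 1 - real (nat \<lceil>2 - Re s\<rceil>)" by linarith
  thus ?thesis
    using eta_level_mono[of "nat \<lceil>2 - Re s\<rceil>" s "max m (nat \<lceil>2 - Re s\<rceil>)"]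
      eta_level_mono[OF assms, of "max m (nat \<lceil>2 - Re s\<rceil>)"] by (simp add: eta_def)
qed

text \<open>Local uniform convergence by the Weierstrass test, with the bound of
  \<open>norm_fdiff_pow_powr_le\<close> made uniform on a closed disc.\<close>

lemma eta_level_holomorphic: "eta_level m holomorphic_on {s. Re s > 1 - real m}"
proof -
  let ?a = "\<lambda>s k. of_nat (Suc k) powr (-s) :: complex"
  have hol: "(\<lambda>s. (fdiff ^^ n) (?a s) k) holomorphic_on A" for n k A
    by (rule fdiff_pow_holomorphic)
       (auto intro!: holomorphic_intros simp: complex_nonpos_Reals_iff simp del: of_nat_Suc)
  have "(\<lambda>s. \<Sum>k. (-1) ^ k * (fdiff ^^ m) (?a s) k) holomorphic_on {s. Re s > 1 - real m}"
  proof (rule holomorphic_uniform_sequence[where f = "\<lambda>n s. \<Sum>k<n. (-1) ^ k * (fdiff ^^ m) (?a s) k"])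
    show "open {s. 1 - real m < Re s}" by (rule open_halfspace_Re_gt)
    show "(\<lambda>s. \<Sum>k<n. (-1) ^ k * (fdiff ^^ m) (?a s) k) holomorphic_on {s. 1 - real m < Re s}" for n
      by (intro holomorphic_intros hol)
  next
    fix x assume x: "x \<in> {s. 1 - real m < Re s}"
    \<comment> \<open>Half the distance from \<open>x\<close> to the boundary line, so that Re s >=
      1 - m + d on the disc and the exponent -Re s - m stays below -1 - d.\<close>
    define d where "d = (Re x - (1 - real m)) / 2"
    define C where "C = (norm x + d + real m) ^ m"
    have d: "d > 0" using x by (simp add: d_def)
    have Re: "Re s \<ge> Re x - d" if "s \<in> cball x d" for s
      using that abs_Re_le_cmod[of "x - s"] by (simp add: dist_norm)
    have x_d: "Re x - d = 1 - real m + d" by (simp add: d_def field_simps)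
    have sub: "cball x d \<subseteq> {s. 1 - real m < Re s}"
      using Re d x_d by force
    have "uniform_limit (cball x d) (\<lambda>n s. \<Sum>k<n. (-1) ^ k * (fdiff ^^ m) (?a s) k)
           (\<lambda>s. \<Sum>k. (-1) ^ k * (fdiff ^^ m) (?a s) k) sequentially"
    proof (rule Weierstrass_m_test)
      fix k s assume s: "s \<in> cball x d"
      have norm_s: "norm s \<le> norm x + d"
        using s norm_triangle_ineq2[of s x] by (simp add: dist_norm norm_minus_commute)
      have "norm (\<Prod>i<m. -s - of_nat i) \<le> (\<Prod>i<m. norm x + d + real m)"
        unfolding prod_norm[symmetric]
      proof (intro prod_mono conjI)
        fix i assume "i \<in> {..<m}"
        thus "norm (-s - of_nat i) \<le> norm x + d + real m"
          using norm_triangle_ineq4[of "-s" "of_nat i"] norm_s by simp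
      qed auto
      hence C: "norm (\<Prod>i<m. -s - of_nat i) \<le> C" by (simp add: C_def)
      have "norm ((-1) ^ k * (fdiff ^^ m) (?a s) k)
              \<le> norm (\<Prod>i<m. -s - of_nat i) * real (Suc k) powr (- Re s - real m)"
        using norm_fdiff_pow_powr_le[of s m k] Re[OF s] x_d d by (simp add: norm_mult norm_power)
      also have "\<dots> \<le> C * real (Suc k) powr (- 1 - d)"
        using Re[OF s] x_d C order_trans[OF norm_ge_zero C]
        by (intro mult_mono powr_mono) auto
      finally show "norm ((-1) ^ k * (fdiff ^^ m) (?a s) k) \<le> C * real (Suc k) powr (- 1 - d)" .
    next
      show "summable (\<lambda>k. C * real (Suc k) powr (- 1 - d))"
        using d by (intro summable_mult summable_Suc_powr) auto
    qed
    with d sub show "\<exists>d>0. cball x d \<subseteq> {s. 1 - real m < Re s} \<and>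
        uniform_limit (cball x d) (\<lambda>n s. \<Sum>k<n. (-1) ^ k * (fdiff ^^ m) (?a s) k)
           (\<lambda>s. \<Sum>k. (-1) ^ k * (fdiff ^^ m) (?a s) k) sequentially"
      by blast
  qed
  thus ?thesis
    unfolding eta_level_def[abs_def] euler_part_def
    by (intro holomorphic_intros hol) auto
qed

lemma eta_holomorphic: "eta holomorphic_on UNIV"
proof -
  have "eta field_differentiable at z" for z
  proof -
    define m where "m = nat \<lceil>2 - Re z\<rceil>"
    have "Re z > 1 - real m" unfolding m_def by linarith
    moreover have "eta holomorphic_on {s. Re s > 1 - real m}"
      using eta_level_holomorphic[of m] by (rule holomorphic_transform) (auto simp: eta_eq_level)
    ultimately show ?thesis
      using holomorphic_on_imp_differentiable_at[OF _ open_halfspace_Re_gt] by auto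
  qed
  thus ?thesis by (auto simp: holomorphic_on_def intro: field_differentiable_at_within)
qed

lemma eta_sums: "Re s > 1 \<Longrightarrow> (\<lambda>k. (-1) ^ k * of_nat (Suc k) powr (-s)) sums eta s"
  using eta_eq_level[of 0 s] summable_fdiff_pow_powr[of 0 s]
  by (simp add: eta_level_def euler_part_def summable_sums)

section \<open>Values of eta at negative integers\<close>

lemma fdiff_pow_sum: "(fdiff ^^ m) (\<lambda>k. \<Sum>i\<in>A. b i k) k = (\<Sum>i\<in>A. (fdiff ^^ m) (b i) k)"
  by (induction m arbitrary: k) (simp_all add: fdiff_def sum_subtractf)

text \<open>Differencing lowers the degree: by the binomial theorem \<open>fdiff\<close> of a
  \<open>k\<close>-th power is a combination of lower powers.\<close>

lemma fdiff_pow_monomial: "k < m \<Longrightarrow> (fdiff ^^ m) (\<lambda>j. of_nat j ^ k) i = 0"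
proof (induction k arbitrary: m i rule: less_induct)
  case (less k)
  then obtain n where n: "m = Suc n" by (cases m) auto
  have "fdiff (\<lambda>j. of_nat j ^ k) = (\<lambda>j. \<Sum>l<k. - of_nat (k choose l) * of_nat j ^ l)"
  proof
    fix j
    have "(of_nat (Suc j) :: complex) ^ k = (\<Sum>l\<le>k. of_nat (k choose l) * of_nat j ^ l)"
      using binomial_ring[of "of_nat j :: complex" 1 k] by (simp add: add.commute)
    also have "\<dots> = of_nat j ^ k + (\<Sum>l<k. of_nat (k choose l) * of_nat j ^ l)"
      by (simp add: lessThan_Suc_atMost[symmetric] add.commute)
    finally show "fdiff (\<lambda>j. of_nat j ^ k) j = (\<Sum>l<k. - of_nat (k choose l) * of_nat j ^ l)"
      by (simp add: fdiff_def sum_negf)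
  qed
  hence "(fdiff ^^ m) (\<lambda>j. of_nat j ^ k) i
           = (\<Sum>l<k. - of_nat (k choose l) * (fdiff ^^ n) (\<lambda>j. of_nat j ^ l) i)"
    by (simp only: n funpow_Suc_right o_apply fdiff_pow_sum fdiff_pow_cmult)
  also have "\<dots> = 0"
    using less n by (intro sum.neutral) auto
  finally show ?case .
qed

lemma euler_part_sum:
  "euler_part m (\<lambda>k. \<Sum>i\<in>A. r i * b i k) = (\<Sum>i\<in>A. r i * euler_part m (b i))"
  unfolding euler_part_def fdiff_pow_sum fdiff_pow_cmult sum_divide_distrib sum_distrib_left
  by (subst sum.swap) simp

text \<open>Exact form of sum (-1)^k b(k) + sum (-1)^k b(k+1) = b(0) for the truncated transform:
  the combined terms telescope, leaving only the \<open>m\<close>-th difference as an error.\<close>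

lemma euler_part_shift:
  assumes "(fdiff ^^ m) b 0 = 0"
  shows "euler_part m b + euler_part m (\<lambda>k. b (Suc k)) = b 0"
proof -
  have "(fdiff ^^ n) (\<lambda>k. b (Suc k)) 0 = (fdiff ^^ n) b 0 - (fdiff ^^ Suc n) b 0" for n
    using fdiff_pow_shift[of n b 1 0] by (simp add: fdiff_def)
  moreover have "(\<Sum>n<m. (2 * (fdiff ^^ n) b 0 - (fdiff ^^ Suc n) b 0) / 2 ^ Suc n)
                   = b 0 - (fdiff ^^ m) b 0 / 2 ^ m"
    by (induction m) (simp_all add: diff_divide_distrib)
  ultimately show ?thesis
    using assms by (simp add: euler_part_def sum.distrib[symmetric] add_divide_distrib[symmetric])
qed

lemma euler_part_power_Suc:
  "euler_part m (\<lambda>j. of_nat (Suc j) ^ k)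
     = (\<Sum>i\<le>k. of_nat (k choose i) * euler_part m (\<lambda>j. of_nat j ^ i))"
proof -
  have "(of_nat (Suc j) :: complex) ^ k = (\<Sum>i\<le>k. of_nat (k choose i) * of_nat j ^ i)" for j
    using binomial_ring[of "of_nat j :: complex" 1 k] by (simp add: add.commute)
  thus ?thesis by (simp only: euler_part_sum)
qed

lemma euler_part_power_rec:
  assumes "k < m"
  shows "euler_part m (\<lambda>j. of_nat j ^ k)
           + (\<Sum>i\<le>k. of_nat (k choose i) * euler_part m (\<lambda>j. of_nat j ^ i)) = 0 ^ k"
  using euler_part_shift[OF fdiff_pow_monomial[OF assms, of 0]]
  by (simp only: euler_part_power_Suc of_nat_0)

text \<open>At s = -k, level k + 2 lies in the range of convergence, and the factor
  \<open>i = k\<close> kills the bound on the differences, so the remaining series is identically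
  0.\<close>

lemma eta_neg_eq_euler_part: "eta (- of_nat k) = euler_part (k + 2) (\<lambda>j. of_nat (Suc j) ^ k)"
proof -
  have pow: "of_nat (Suc j) powr of_nat k = (of_nat (Suc j) :: complex) ^ k" for j
    by (rule powr_nat') (simp del: of_nat_Suc)
  have "(\<Prod>i<k+2. of_nat k - of_nat i) = (0 :: complex)"
    by (rule prod_zero) (auto intro!: bexI[of _ k])
  hence "(fdiff ^^ (k + 2)) (\<lambda>j. of_nat (Suc j) powr of_nat k) i = 0" for i
    using norm_fdiff_pow_powr_le[of "- of_nat k" "k + 2" i] by simp
  thus ?thesis
    using eta_eq_level[of "k + 2" "- of_nat k"]
    by (simp add: eta_level_def pow del: of_nat_Suc funpow.simps)
qed

section \<open>Taylor coefficients of the Fermi function\<close>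

text \<open>Logarithmic derivative of Gamma(1/2 + z) Gamma(1/2 - z) cos(pi z) = pi, multiplied out
  to avoid dividing by the cosine. The strip keeps both Gamma arguments in the right
  half-plane.\<close>

lemma Digamma_half_reflection:
  fixes z :: complex
  assumes "\<bar>Re z\<bar> < 1 / 2"
  shows "(Digamma (1/2 + z) - Digamma (1/2 - z)) * cos (of_real pi * z) = of_real pi * sin (of_real pi * z)"
proof -
  have nonpos: "w \<notin> \<int>\<^sub>\<le>\<^sub>0" if "Re w > 0" for w :: complex
    using that by (auto elim!: nonpos_Ints_cases')
  have pos: "1/2 + z \<notin> \<int>\<^sub>\<le>\<^sub>0" "1/2 - z \<notin> \<int>\<^sub>\<le>\<^sub>0"
    using assms by (auto intro!: nonpos)
  define S where "S = {z :: complex. Re z > -1/2} \<inter> {z. Re z < 1/2}"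
  define P where "P = (\<lambda>z :: complex. Gamma (1/2 + z) * Gamma (1/2 - z) * cos (of_real pi * z))"
  have "open S" unfolding S_def by (intro open_Int open_halfspace_Re_gt open_halfspace_Re_lt)
  have P: "P w = of_real pi" if "w \<in> S" for w
  proof -
    have "Gamma (1/2 + w) * Gamma (1 - (1/2 + w)) = of_real pi / sin (of_real pi * (1/2 + w))"
      by (rule Gamma_reflection_complex)
    moreover have "sin (of_real pi * (1/2 + w)) = cos (of_real pi * w)"
      using sin_of_real[of "pi / 2", where ?'a = complex] cos_of_real[of "pi / 2", where ?'a = complex]
      by (simp add: algebra_simps sin_add)
    moreover have "Gamma (1/2 + w) \<noteq> 0" "Gamma (1/2 - w) \<noteq> 0"
      using that by (auto simp: S_def Gamma_eq_zero_iff intro!: nonpos)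
    moreover have "1 - (1/2 + w) = 1/2 - w" by simp
    ultimately show ?thesis
      by (auto simp: P_def field_simps split: if_splits)
  qed
  have "z \<in> S" using assms by (auto simp: S_def)
  have "(P has_field_derivative 0) (at z)"
  proof (rule has_field_derivative_transform_within_open)
    show "((\<lambda>_. of_real pi) has_field_derivative 0) (at z)" by simp
  qed (use \<open>open S\<close> \<open>z \<in> S\<close> P in auto)
  moreover have "(P has_field_derivative
      Gamma (1/2 + z) * Gamma (1/2 - z) * ((Digamma (1/2 + z) - Digamma (1/2 - z)) * cos (of_real pi * z)
        - of_real pi * sin (of_real pi * z))) (at z)"
    unfolding P_def using pos by (auto intro!: derivative_eq_intros simp: algebra_simps)
  ultimately have "Gamma (1/2 + z) * Gamma (1/2 - z) * ((Digamma (1/2 + z) - Digamma (1/2 - z)) * cos (of_real pi * z)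
        - of_real pi * sin (of_real pi * z)) = 0"
    by (metis DERIV_unique)
  thus ?thesis using pos by (simp add: Gamma_eq_zero_iff)
qed

text \<open>The function \<open>1 / (exp (2 \<pi> \<i> z) + 1)\<close>, written through its partial fractions so that its Taylor
  coefficients at 0 are sums of reciprocal odd powers.\<close>
definition fermi :: "complex \<Rightarrow> complex" where
  "fermi z = 1 / 2 - \<i> / (2 * of_real pi) * (Digamma (1/2 + z) - Digamma (1/2 - z))"

text \<open>With w = pi z and e = exp(i w), the reflection formula gives 1/2 - (i/2) tan w = (1/e) /
  (e + 1/e) = 1 / (e^2 + 1).\<close>

lemma fermi_eq:
  assumes "\<bar>Re z\<bar> < 1 / 2"
  shows "fermi z * exp (2 * of_real pi * \<i> * z) + fermi z = 1"
proof -
  define w where "w = of_real pi * z"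
  \<comment> \<open>A zero of the cosine would make Re z an integer plus 1/2, which the strip
    excludes.\<close>
  have cos: "cos w \<noteq> 0"
  proof
    assume "cos w = 0"
    then obtain n where n: "w = of_real (real_of_int n * pi) + of_real pi / 2"
      by (auto simp: cos_eq_0)
    hence "pi * Re z = pi * (real_of_int n + 1 / 2)"
      by (simp add: w_def complex_eq_iff algebra_simps)
    hence "Re z = real_of_int n + 1 / 2" by simp
    hence "\<bar>real_of_int (2 * n + 1)\<bar> < real_of_int 1" using assms by (simp add: field_simps)
    hence "\<bar>2 * n + 1\<bar> < 1" by linarith
    thus False by presburger
  qed
  have "Digamma (1/2 + z) - Digamma (1/2 - z) = of_real pi * sin w / cos w"
    using Digamma_half_reflection[OF assms] cos by (simp add: w_def field_simps)
  hence "fermi z = (cos w - \<i> * sin w) / (2 * cos w)"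
    using cos by (simp only: fermi_def) (simp add: field_simps)
  moreover define e where "e = exp (\<i> * w)"
  have e: "e \<noteq> 0" by (simp add: e_def)
  have "cos w - \<i> * sin w = 1 / e"
    using exp_Euler[of "- w"] by (simp add: e_def exp_minus field_simps)
  moreover have "2 * cos w = e + 1 / e"
    by (simp add: cos_exp_eq e_def exp_minus field_simps)
  ultimately have "fermi z = (1 / e) / (e + 1 / e)" "e + 1 / e \<noteq> 0"
    using cos by auto
  moreover have "exp (2 * of_real pi * \<i> * z) = e * e"
    by (simp add: w_def e_def mult_ac flip: exp_add)
  ultimately show ?thesis
    using e by (simp add: divide_simps) (simp add: algebra_simps)
qed

text \<open>The reflection z -> -z in the second Digamma contributes (-1)^n: odd orders double, and
  even orders vanish, which is the source of the trivial zeros of zeta.\<close>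

lemma higher_deriv_fermi_0:
  assumes "n > 0"
  shows "(deriv ^^ n) fermi 0 = - (\<i> / (2 * of_real pi)) * (1 - (-1) ^ n) * Polygamma n (1/2)"
proof -
  define S where "S = ball (0 :: complex) (1/2)"
  define T where "T = {z :: complex. Re z > 0}"
  have T: "open T" unfolding T_def by (rule open_halfspace_Re_gt)
  have ST: "1/2 + z \<in> T" "1/2 - z \<in> T" if "z \<in> S" for z
    using that abs_Re_le_cmod[of z] by (auto simp: S_def T_def)
  have nonpos: "T \<inter> \<int>\<^sub>\<le>\<^sub>0 = {}"
    by (auto simp: T_def elim!: nonpos_Ints_cases')
  have hol: "Digamma holomorphic_on T"
    using nonpos by (intro holomorphic_intros)
  have hol_comp: "(\<lambda>z. Digamma (1/2 + z)) holomorphic_on S" "(\<lambda>z. Digamma (1/2 - z)) holomorphic_on S"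
    using ST by (auto intro!: holomorphic_on_compose_gen[OF _ hol, unfolded o_def] holomorphic_intros)
  have S: "open S" "0 \<in> S" by (auto simp: S_def)
  have half: "1/2 \<notin> (\<int>\<^sub>\<le>\<^sub>0 :: complex set)" using nonpos by (auto simp: T_def)
  have 1: "(deriv ^^ n) (\<lambda>z. Digamma (1/2 + z)) 0 = Polygamma n (1/2 :: complex)"
    using higher_deriv_compose_linear'[OF hol S(1) T S(2), of 1 "1/2" n] ST half
    by (simp add: add.commute higher_deriv_Polygamma)
  have 2: "(deriv ^^ n) (\<lambda>z. Digamma (1/2 - z)) 0 = (-1) ^ n * Polygamma n (1/2 :: complex)"
    using higher_deriv_compose_linear'[OF hol S(1) T S(2), of "-1" "1/2" n] ST half
    by (simp add: higher_deriv_Polygamma)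
  have "(deriv ^^ n) fermi 0 = (deriv ^^ n) (\<lambda>_. 1/2) 0
     - (deriv ^^ n) (\<lambda>z. \<i> / (2 * of_real pi) * (Digamma (1/2 + z) - Digamma (1/2 - z))) 0"
    unfolding fermi_def[abs_def]
    by (rule higher_deriv_diff[OF _ _ S]) (intro holomorphic_intros hol_comp)+
  also have "(deriv ^^ n) (\<lambda>z. \<i> / (2 * of_real pi) * (Digamma (1/2 + z) - Digamma (1/2 - z))) 0
     = \<i> / (2 * of_real pi) * (deriv ^^ n) (\<lambda>z. Digamma (1/2 + z) - Digamma (1/2 - z)) 0"
    by (rule higher_deriv_cmult[OF _ S(2,1)]) (intro holomorphic_intros hol_comp)+
  also have "(deriv ^^ n) (\<lambda>z. Digamma (1/2 + z) - Digamma (1/2 - z)) 0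
     = Polygamma n (1/2) - (-1) ^ n * Polygamma n (1/2 :: complex)"
    unfolding 2[symmetric] unfolding 1[symmetric] by (rule higher_deriv_diff[OF hol_comp S])
  finally show ?thesis using assms by (simp add: ring_distribs)
qed

text \<open>Differentiate the equation of \<open>fermi_eq\<close> \<open>n\<close> times at 0 by the
  Leibniz rule and divide by (2 pi i)^n.\<close>

lemma fermi_coeff_rec:
  defines "h \<equiv> \<lambda>n. (deriv ^^ n) fermi 0 / (2 * of_real pi * \<i>) ^ n"
  shows "h n + (\<Sum>i\<le>n. of_nat (n choose i) * h i) = 0 ^ n"
proof -
  define c where "c = 2 * of_real pi * \<i>"
  have c: "c \<noteq> 0" by (simp add: c_def)
  define S where "S = ball (0 :: complex) (1/2)"
  have S: "open S" "0 \<in> S" by (auto simp: S_def)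
  have Re: "\<bar>Re z\<bar> < 1/2" if "z \<in> S" for z
    using that abs_Re_le_cmod[of z] by (auto simp: S_def)
  have hol: "fermi holomorphic_on S"
    unfolding fermi_def[abs_def]
    by (intro holomorphic_intros holomorphic_on_compose_gen[OF _ holomorphic_on_Polygamma[of "{z. Re z > 0}"], unfolded o_def])
       (use Re in \<open>force elim!: nonpos_Ints_cases'\<close>)+
  have hol2: "(\<lambda>z. exp (c * z)) holomorphic_on S" by (intro holomorphic_intros)
  have "(deriv ^^ n) (\<lambda>z. fermi z * exp (c * z) + fermi z) 0 = (deriv ^^ n) (\<lambda>z. 1) 0"
    by (rule higher_deriv_transform_within_open[OF _ _ S])
       (auto intro!: holomorphic_intros hol fermi_eq Re simp: c_def)
  moreover have "(deriv ^^ n) (\<lambda>z. fermi z * exp (c * z) + fermi z) 0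
      = (deriv ^^ n) (\<lambda>z. fermi z * exp (c * z)) 0 + (deriv ^^ n) fermi 0"
    by (rule higher_deriv_add[OF _ _ S]) (intro holomorphic_intros hol hol2)+
  moreover have "(deriv ^^ k) (\<lambda>z. exp (c * z)) = (\<lambda>z. c ^ k * exp (c * z))" for k
    by (induction k) (auto intro!: DERIV_imp_deriv derivative_eq_intros)
  hence "(deriv ^^ n) (\<lambda>z. fermi z * exp (c * z)) 0
      = (\<Sum>i\<le>n. of_nat (n choose i) * (deriv ^^ i) fermi 0 * c ^ (n - i))"
    using higher_deriv_mult[OF hol hol2 S] by (simp add: atMost_atLeast0)
  moreover have "(\<Sum>i\<le>n. of_nat (n choose i) * (deriv ^^ i) fermi 0 * c ^ (n - i))
      = c ^ n * (\<Sum>i\<le>n. of_nat (n choose i) * h i)"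
    unfolding sum_distrib_left
  proof (rule sum.cong)
    fix i assume "i \<in> {..n}"
    hence "c ^ n = c ^ i * c ^ (n - i)" by (simp flip: power_add)
    thus "of_nat (n choose i) * (deriv ^^ i) fermi 0 * c ^ (n - i) = c ^ n * (of_nat (n choose i) * h i)"
      using c by (simp add: h_def c_def)
  qed simp
  moreover have "(deriv ^^ n) fermi 0 = c ^ n * h n"
    using c by (simp add: h_def c_def)
  ultimately have "c ^ n * (h n + (\<Sum>i\<le>n. of_nat (n choose i) * h i)) = c ^ n * 0 ^ n"
    by (cases n) (simp_all add: algebra_simps)
  thus ?thesis using c by simp
qed

text \<open>The summand \<open>i = n\<close> makes the coefficient of x_n equal to 2, so earlier
  values determine x_n. The recursion is assumed only below \<open>m\<close>, as a truncated Euler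
  transform satisfies it only there.\<close>

lemma binomial_rec_unique:
  fixes x y :: "nat \<Rightarrow> complex"
  assumes "\<And>n. n < m \<Longrightarrow> x n + (\<Sum>i\<le>n. of_nat (n choose i) * x i) = r n"
    and "\<And>n. n < m \<Longrightarrow> y n + (\<Sum>i\<le>n. of_nat (n choose i) * y i) = r n"
    and "n < m"
  shows "x n = y n"
  using \<open>n < m\<close>
proof (induction n rule: less_induct)
  case (less n)
  have "(\<Sum>i<n. of_nat (n choose i) * x i) = (\<Sum>i<n. of_nat (n choose i) * y i)"
    using less by (intro sum.cong) auto
  with assms(1,2)[OF less.prems] show ?case
    by (simp flip: lessThan_Suc_atMost) (metis add_right_cancel mult_cancel_left zero_neq_numeral)
qed

lemma eta_neg: "k > 0 \<Longrightarrow> eta (- of_nat k) = - ((deriv ^^ k) fermi 0 / (2 * of_real pi * \<i>) ^ k)"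
proof -
  assume k: "k > 0"
  \<comment> \<open>A single truncation level serves all exponents up to k + 1, so that the
    recursion links values of the same transform.\<close>
  let ?x = "\<lambda>i. euler_part (k + 2) (\<lambda>j. of_nat j ^ i)"
  have "?x k = (deriv ^^ k) fermi 0 / (2 * of_real pi * \<i>) ^ k"
  proof (rule binomial_rec_unique[of "k + 2" ?x "\<lambda>n. 0 ^ n"])
    show "?x n + (\<Sum>i\<le>n. of_nat (n choose i) * ?x i) = 0 ^ n" if "n < k + 2" for n
      by (rule euler_part_power_rec[OF that])
  qed (rule fermi_coeff_rec, simp)
  \<comment> \<open>The series of eta starts at 1 rather than 0; shifting the index reverses the
    sign, and 0^k = 0 because k > 0.\<close>
  moreover have "eta (- of_nat k) = - ?x k"
    using euler_part_power_rec[of k "k + 2"] k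
    by (simp only: eta_neg_eq_euler_part euler_part_power_Suc) (simp add: add_eq_0_iff power_0_left)
  ultimately show ?thesis by simp
qed

section \<open>The zeta function\<close>

text \<open>Subtracting the odd-indexed terms twice flips their signs.\<close>

lemma sums_alternating:
  fixes a :: "nat \<Rightarrow> 'a :: real_normed_field"
  assumes "a sums z" "(\<lambda>n. a (2 * n + 1)) sums y"
  shows "(\<lambda>n. (-1) ^ n * a n) sums (z - 2 * y)"
proof -
  let ?b = "\<lambda>n. if odd n then 2 * a n else 0"
  have "strict_mono (\<lambda>n::nat. 2 * n + 1)" by (auto simp: strict_mono_def)
  hence "(\<lambda>n. ?b (2 * n + 1)) sums (2 * y) \<longleftrightarrow> ?b sums (2 * y)"
  proof (rule sums_mono_reindex)
    fix n :: nat assume *: "n \<notin> range (\<lambda>n. 2 * n + 1)"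
    have "even n"
    proof (rule ccontr)
      assume "odd n"
      then obtain k where "n = 2 * k + 1" by (rule oddE)
      with * show False by blast
    qed
    thus "?b n = 0" by simp
  qed
  moreover have "(\<lambda>n. ?b (2 * n + 1)) sums (2 * y)"
    using sums_mult[OF assms(2), of 2] by simp
  ultimately have "?b sums (2 * y)" by (rule iffD1)
  from sums_diff[OF assms(1) this] have "(\<lambda>n. a n - ?b n) sums (z - 2 * y)" .
  moreover have "(\<lambda>n. a n - ?b n) = (\<lambda>n. (-1) ^ n * a n)" by auto
  ultimately show ?thesis by simp
qed

text \<open>The even integers contribute 2^(-s) times the full series and are subtracted
  twice.\<close>

lemma eta_eq_dirichlet_series:
  assumes "Re s > 1" "(\<lambda>n. 1 / of_nat (Suc n) powr s) sums z"
  shows "eta s = (1 - 2 powr (1 - s)) * z"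
proof -
  have "1 / of_nat (Suc (2 * n + 1)) powr s = 2 powr (-s) * (1 / of_nat (Suc n) powr s)" for n
    using powr_times_real[of 2 "of_nat (Suc n)" s]
    by (simp add: powr_minus divide_simps algebra_simps)
  with sums_mult[OF assms(2), of "2 powr (-s)"]
  have "(\<lambda>n. 1 / of_nat (Suc (2 * n + 1)) powr s) sums (2 powr (-s) * z)" by (simp del: of_nat_Suc)
  from sums_alternating[OF assms(2) this]
  have "(\<lambda>n. (-1) ^ n * (of_nat (Suc n)) powr (-s)) sums (z - 2 * (2 powr (-s) * z))"
    by (simp add: powr_minus divide_inverse del: of_nat_Suc)
  with eta_sums[OF assms(1)] have "eta s = z - 2 * (2 powr (-s) * z)"
    using sums_unique2 by blast
  moreover have "2 powr (1 - s) = 2 * 2 powr (-s)"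
    by (simp add: powr_diff powr_minus divide_inverse)
  ultimately show ?thesis by (simp add: algebra_simps)
qed

lemma two_powr_ne_1: "Re s > 1 \<Longrightarrow> 2 powr (1 - s) \<noteq> 1"
proof
  assume "Re s > 1" "2 powr (1 - s) = 1"
  hence "norm (2 powr (1 - s)) = 1" by simp
  hence "2 powr (1 - Re s) = 1" by (simp add: norm_powr_real_powr)
  thus False using \<open>Re s > 1\<close> by (simp add: powr_eq_one_iff)
qed

text \<open>At zeros of the denominator this has the default value 0 of division, right or not;
  \<open>remove_sings\<close> corrects it in \<open>zeta_eq\<close>.\<close>

definition zeta_quot :: "complex \<Rightarrow> complex" where
  "zeta_quot s = eta s / (1 - 2 powr (1 - s))"

lemma eta_analytic: "eta analytic_on A"
  using eta_holomorphic analytic_on_subset[OF _ subset_UNIV] by (metis analytic_on_open open_UNIV)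

lemma two_powr_analytic: "(\<lambda>s. 1 - 2 powr (1 - s) :: complex) analytic_on A"
proof -
  have "(\<lambda>s. 1 - 2 powr (1 - s) :: complex) holomorphic_on UNIV"
    by (intro holomorphic_intros) (auto simp: complex_nonpos_Reals_iff)
  thus ?thesis
    using analytic_on_subset[OF _ subset_UNIV] by (metis analytic_on_open open_UNIV)
qed

lemma zeta_quot_analytic: "2 powr (1 - s) \<noteq> 1 \<Longrightarrow> zeta_quot analytic_on {s}"
  unfolding zeta_quot_def[abs_def]
  by (rule analytic_on_divide[OF eta_analytic two_powr_analytic]) simp

lemma zeta_quot_meromorphic: "zeta_quot meromorphic_on UNIV"
  unfolding zeta_quot_def[abs_def]
  by (intro meromorphic_on_divide analytic_on_imp_meromorphic_on eta_analytic two_powr_analytic)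

text \<open>A meromorphic difference is either 0 or nonzero off a discrete set, and agreement on
  \<open>A\<close> excludes the second case. Hence \<open>f\<close> and \<open>g\<close> agree near
  every point, and niceness recovers the value at the point itself: the limit, or 0 at a
  pole.\<close>

lemma nicely_meromorphic_unique:
  assumes "f nicely_meromorphic_on UNIV" "g nicely_meromorphic_on UNIV"
    and "open A" "A \<noteq> {}" "\<And>s. s \<in> A \<Longrightarrow> f s = g s"
  shows "f = g"
proof
  fix z
  have mero: "f meromorphic_on UNIV" "g meromorphic_on UNIV"
    using assms by (auto simp: nicely_meromorphic_on_def)
  from \<open>A \<noteq> {}\<close> obtain a where "a \<in> A" by blast
  have "(\<lambda>s. f s - g s) meromorphic_on UNIV" by (intro meromorphic_intros mero)
  from meromorphic_imp_constant_or_avoid[OF this, of 0]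
  have "eventually (\<lambda>s. f s = g s) (at z)"
  proof
    assume "\<forall>\<^sub>\<approx>s\<in>UNIV. f s - g s = 0"
    thus ?thesis by (simp add: eventually_cosparse_open_eq)
  next
    assume "\<forall>\<^sub>\<approx>s\<in>UNIV. f s - g s \<noteq> 0"
    hence "eventually (\<lambda>s. f s \<noteq> g s) (at a)" by (simp add: eventually_cosparse_open_eq)
    moreover have "eventually (\<lambda>s. s \<in> A) (at a)"
      using \<open>open A\<close> \<open>a \<in> A\<close> by (rule eventually_at_in_open')
    ultimately have "eventually (\<lambda>_. False) (at a)"
      by eventually_elim (use assms in auto)
    thus ?thesis by simp
  qed auto
  hence pole: "is_pole f z \<longleftrightarrow> is_pole g z" and lim: "f \<midarrow>z\<rightarrow> l \<longleftrightarrow> g \<midarrow>z\<rightarrow> l" for l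
    by (simp_all add: is_pole_cong tendsto_cong)
  have *: "(is_pole f z \<and> f z = 0) \<or> f \<midarrow>z\<rightarrow> f z" "(is_pole g z \<and> g z = 0) \<or> g \<midarrow>z\<rightarrow> g z"
    using assms by (auto simp: nicely_meromorphic_on_def)
  show "f z = g z"
  proof (cases "is_pole f z")
    case True
    thus ?thesis using * pole not_tendsto_and_filterlim_at_infinity[of "at z"]
      by (auto simp: is_pole_def)
  next
    case False
    thus ?thesis using * pole lim LIM_unique by blast
  qed
qed

lemma zeta_eq: "zeta = remove_sings zeta_quot"
proof -
  have nice: "remove_sings zeta_quot nicely_meromorphic_on UNIV"
    by (rule remove_sings_nicely_meromorphic[OF zeta_quot_meromorphic])
  have sums: "(\<lambda>n. 1 / of_nat (Suc n) powr s) sums remove_sings zeta_quot s" if s: "Re s > 1" for s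
  proof -
    have "summable (\<lambda>n. 1 / of_nat (Suc n) powr s)"
    proof (rule summable_norm_cancel)
      have "norm (1 / of_nat (Suc n) powr s) = real (Suc n) powr (- Re s)" for n
        using norm_powr_real_powr[of "of_nat (Suc n)" s]
        by (simp add: norm_divide norm_inverse powr_minus divide_inverse del: of_nat_Suc)
      thus "summable (\<lambda>n. norm (1 / of_nat (Suc n) powr s))"
        using summable_Suc_powr[of "- Re s"] s by simp
    qed
    then obtain z where z: "(\<lambda>n. 1 / of_nat (Suc n) powr s) sums z"
      by (auto simp: summable_def)
    moreover have "z = zeta_quot s"
      using eta_eq_dirichlet_series[OF s z] two_powr_ne_1[OF s] by (simp add: zeta_quot_def)
    ultimately show ?thesis
      using remove_sings_at_analytic[OF zeta_quot_analytic[OF two_powr_ne_1[OF s]]] by simp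
  qed
  show ?thesis
    unfolding zeta_def
  proof (rule the_equality)
    fix f assume f: "f nicely_meromorphic_on UNIV \<and>
      (\<forall>s. Re s > 1 \<longrightarrow> (\<lambda>n. 1 / of_nat (Suc n) powr s) sums f s)"
    show "f = remove_sings zeta_quot"
    proof (rule nicely_meromorphic_unique)
      show "open {s. Re s > 1}" by (rule open_halfspace_Re_gt)
      have "2 \<in> {s. Re s > 1}" by simp
      thus "{s. Re s > 1} \<noteq> {}" by blast
      show "f s = remove_sings zeta_quot s" if "s \<in> {s. Re s > 1}" for s
        using that f sums sums_unique2 by blast
    qed (use f nice in auto)
  qed (use nice sums in auto)
qed

text \<open>The denominator 1 - 2^(k+1) is nonzero, so the quotient is analytic at -k and
  \<open>remove_sings\<close> leaves its value unchanged.\<close>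

lemma zeta_neg: "zeta (- of_nat k) = eta (- of_nat k) / (1 - 2 ^ Suc k)"
proof -
  have "(2 :: complex) powr (1 - (- of_nat k)) = 2 powr of_nat (Suc k)" by simp
  also have "\<dots> = 2 ^ Suc k" by (rule powr_nat') simp
  finally have 2: "(2 :: complex) powr (1 - (- of_nat k)) = 2 ^ Suc k" .
  have "(2 :: complex) ^ Suc k \<noteq> 1"
  proof
    assume "(2 :: complex) ^ Suc k = 1"
    hence "norm ((2 :: complex) ^ Suc k) = 1" by simp
    hence "(2 :: real) ^ Suc k = 1" by (simp only: norm_power norm_numeral)
    thus False using one_less_power[of "2::real" "Suc k"] by (simp del: power_Suc)
  qed
  hence "zeta_quot analytic_on {- of_nat k}"
    by (intro zeta_quot_analytic) (simp only: 2 not_False_eq_True)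
  hence "zeta (- of_nat k) = zeta_quot (- of_nat k)"
    unfolding zeta_eq by (rule remove_sings_at_analytic)
  thus ?thesis by (simp only: zeta_quot_def 2)
qed

lemma zeta_neg_even:
  assumes "even k" "k > 0"
  shows "zeta (- of_nat k) = 0"
  using assms by (simp add: zeta_neg eta_neg higher_deriv_fermi_0)

section \<open>Zeta at odd negative integers through real zeta values\<close>

definition zeta_real :: "nat \<Rightarrow> real" where
  "zeta_real n = (\<Sum>k. 1 / real (Suc k) ^ n)"

lemma zeta_real_sums: "n \<ge> 2 \<Longrightarrow> (\<lambda>k. 1 / real (Suc k) ^ n) sums zeta_real n"
  unfolding zeta_real_def
  using inverse_power_summable[of n, where ?'a = real]
  by (intro summable_sums) (simp only: summable_Suc_iff[of "\<lambda>k. 1 / real k ^ n"] inverse_eq_divide)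

text \<open>The left side is the series of Polygamma at 1/2: each term is 2^n / (2k+1)^n, and the
  odd integers contribute (1 - 2^(-n)) zeta(n).\<close>

lemma odd_reciprocal_power_sums:
  assumes "n \<ge> 2"
  shows "(\<lambda>k. inverse (1/2 + real k) ^ n) sums ((2 ^ n - 1) * zeta_real n)"
proof -
  note z = zeta_real_sums[OF assms]
  have "(\<lambda>k. 1 / real (Suc (2 * k + 1)) ^ n) sums (zeta_real n / 2 ^ n)"
  proof -
    have "1 / real (Suc (2 * k + 1)) ^ n = 1 / real (Suc k) ^ n / 2 ^ n" for k
      by (simp flip: power_mult_distrib add: algebra_simps)
    with sums_divide[OF z, of "2 ^ n"] show ?thesis by simp
  qed
  \<comment> \<open>Averaging the plain and the alternating series keeps the even indices, that is,
    the odd integers \<open>Suc k\<close>.\<close>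
  from sums_alternating[OF z this]
  have "(\<lambda>k. (1 / real (Suc k) ^ n + (-1) ^ k * (1 / real (Suc k) ^ n)) / 2) sums
          ((zeta_real n + (zeta_real n - 2 * (zeta_real n / 2 ^ n))) / 2)"
    by (intro sums_divide sums_add z)
  moreover have "(\<lambda>k. (1 / real (Suc k) ^ n + (-1) ^ k * (1 / real (Suc k) ^ n)) / 2)
      = (\<lambda>k. if even k then 1 / real (Suc k) ^ n else 0)" by (auto simp: fun_eq_iff)
  moreover have "(zeta_real n + (zeta_real n - 2 * (zeta_real n / 2 ^ n))) / 2 = zeta_real n - zeta_real n / 2 ^ n"
    by simp
  ultimately have "(\<lambda>k. if even k then 1 / real (Suc k) ^ n else 0) sums (zeta_real n - zeta_real n / 2 ^ n)"
    by (simp only:)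
  moreover have "strict_mono (\<lambda>n::nat. 2 * n)" by (auto simp: strict_mono_def)
  moreover have "(if even k then 1 / real (Suc k) ^ n else 0) = 0" if "k \<notin> range (\<lambda>n. 2 * n)" for k
    using that by (metis evenE rangeI)
  ultimately have "(\<lambda>k. if even (2 * k) then 1 / real (Suc (2 * k)) ^ n else 0) sums
      (zeta_real n - zeta_real n / 2 ^ n)"
    by (subst sums_mono_reindex[where f = "\<lambda>k. if even k then 1 / real (Suc k) ^ n else 0"])
  hence "(\<lambda>k. 1 / real (Suc (2 * k)) ^ n) sums (zeta_real n - zeta_real n / 2 ^ n)"
    by simp
  from sums_mult[OF this, of "2 ^ n"]
  have "(\<lambda>k. 2 ^ n * (1 / real (Suc (2 * k)) ^ n)) sums ((2 ^ n - 1) * zeta_real n)"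
    by (simp add: algebra_simps)
  moreover have "2 ^ n * (1 / real (Suc (2 * k)) ^ n) = inverse (1/2 + real k) ^ n" for k
  proof -
    have "inverse (1/2 + real k) = 2 / real (Suc (2 * k))" by (simp add: field_simps)
    thus ?thesis by (simp only: power_divide) simp
  qed
  ultimately show ?thesis by simp
qed

text \<open>Polygamma at 1/2 carries a factor 2^(k+1) - 1, which cancels the denominator of
  \<open>zeta_neg\<close>. Taking norms disposes of the powers of i.\<close>

lemma norm_zeta_neg_odd:
  assumes "odd k"
  shows "norm (zeta (- of_nat k)) = 2 * fact k * zeta_real (Suc k) / (2 * pi) ^ Suc k"
proof -
  have k: "k > 0" using assms by (auto elim: oddE)
  have "(\<lambda>j. inverse ((1/2 + real j) ^ Suc k)) sums ((-1) ^ Suc k * Polygamma k (1/2) / fact k)"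
    using k by (intro Polygamma_LIMSEQ) auto
  hence "Polygamma k (1/2) / fact k = (2 ^ Suc k - 1) * zeta_real (Suc k)"
    using odd_reciprocal_power_sums[of "Suc k"] k assms sums_unique2
    by (fastforce simp: power_inverse)
  hence P: "Polygamma k (1/2) = fact k * ((2 ^ Suc k - 1) * zeta_real (Suc k))"
    by (simp add: field_simps)
  have pos: "zeta_real (Suc k) \<ge> 0"
    using k by (intro sums_le[OF _ sums_zero zeta_real_sums]) auto
  have Pc: "norm (Polygamma k (1/2 :: complex)) = fact k * ((2 ^ Suc k - 1) * zeta_real (Suc k))"
  proof -
    have "Polygamma k (1/2 :: complex) = of_real (Polygamma k (1/2))"
      using Polygamma_of_real[of "1/2" k, where ?'a = complex] by simp
    moreover have "(1 :: real) \<le> 2 ^ Suc k" by (rule one_le_power) simp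
    ultimately show ?thesis
      using pos by (simp only: norm_of_real P) simp
  qed
  have 2: "norm (1 - 2 ^ Suc k :: complex) = 2 ^ Suc k - 1"
  proof -
    have "1 - 2 ^ Suc k = - complex_of_real (2 ^ Suc k - 1 :: real)" by simp
    moreover have "(1 :: real) \<le> 2 ^ Suc k" by (rule one_le_power) simp
    ultimately show ?thesis by (simp only: norm_minus_cancel norm_of_real)
  qed
  have "(1::real) < 2 ^ Suc k" by (rule one_less_power) simp_all
  hence ne: "(2::real) ^ Suc k - 1 \<noteq> 0" by linarith
  have "norm ((deriv ^^ k) fermi 0) = norm (Polygamma k (1/2 :: complex)) / pi"
    using assms k by (simp add: higher_deriv_fermi_0 norm_mult norm_divide)
  hence "norm (eta (- of_nat k)) = fact k * ((2 ^ Suc k - 1) * zeta_real (Suc k)) / pi / (2 * pi) ^ k"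
    using k by (simp only: eta_neg norm_minus_cancel norm_divide Pc)
      (simp add: norm_mult norm_power power_mult_distrib)
  hence "norm (zeta (- of_nat k))
           = fact k * ((2 ^ Suc k - 1) * zeta_real (Suc k)) / pi / (2 * pi) ^ k / (2 ^ Suc k - 1)"
    by (simp only: zeta_neg norm_divide 2)
  also have "\<dots> = fact k * zeta_real (Suc k) / pi / (2 * pi) ^ k"
  proof -
    have "a * (c * b) / p / q / c = a * b / p / q" if "c \<noteq> 0" for a b c p q :: real
      using that by simp
    from this[OF ne] show ?thesis .
  qed
  also have "\<dots> = 2 * fact k * zeta_real (Suc k) / (2 * pi) ^ Suc k"
    by (simp add: field_simps)
  finally show ?thesis .
qed

section \<open>Weights and limiting terms\<close>

lemma zeta_real_ge_1: "n \<ge> 2 \<Longrightarrow> zeta_real n \<ge> 1"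
  using sum_le_suminf[of "\<lambda>k. 1 / real (Suc k) ^ n" "{0}"] zeta_real_sums[of n]
  by (simp add: sums_iff)

lemma zeta_real_antimono: "2 \<le> m \<Longrightarrow> m \<le> n \<Longrightarrow> zeta_real n \<le> zeta_real m"
  by (rule sums_le[OF _ zeta_real_sums zeta_real_sums])
     (auto intro!: divide_left_mono power_increasing)

text \<open>For m >= 2 one has m^n >= 2^(n-2) m^2, so the tail is at most 2^(2-n) (pi^2/6 - 1), and
  pi^2/6 - 1 <= 3/4.\<close>

lemma zeta_real_le:
  assumes "n \<ge> 2"
  shows "zeta_real n \<le> 1 + 3 / 2 ^ n"
proof -
  have pi: "pi\<^sup>2 / 6 - 1 \<le> 3 / 4"
  proof -
    have "pi\<^sup>2 \<le> 3.2\<^sup>2" using pi_approx by (intro power_mono) auto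
    thus ?thesis by (simp add: power2_eq_square)
  qed
  have 1: "(\<lambda>k. 1 / real (Suc (Suc k)) ^ n) sums (zeta_real n - 1)"
    using zeta_real_sums[OF assms] sums_Suc_iff[of "\<lambda>k. 1 / real (Suc k) ^ n" "zeta_real n - 1"] by simp
  have "(\<lambda>k. 1 / real (Suc (Suc k)) ^ 2) sums (pi\<^sup>2 / 6 - 1)"
    using inverse_squares_sums sums_Suc_iff[of "\<lambda>k. 1 / real (Suc k) ^ 2" "pi\<^sup>2 / 6 - 1"]
    by (simp add: add.commute)
  hence 2: "(\<lambda>k. 1 / 2 ^ (n - 2) * (1 / real (Suc (Suc k)) ^ 2)) sums (1 / 2 ^ (n - 2) * (pi\<^sup>2 / 6 - 1))"
    by (rule sums_mult)
  have "1 / real (Suc (Suc k)) ^ n \<le> 1 / 2 ^ (n - 2) * (1 / real (Suc (Suc k)) ^ 2)" for k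
  proof -
    have "real (Suc (Suc k)) ^ n = real (Suc (Suc k)) ^ (n - 2) * real (Suc (Suc k)) ^ 2"
      using assms by (metis le_add_diff_inverse2 power_add)
    moreover have "(2::real) ^ (n - 2) \<le> real (Suc (Suc k)) ^ (n - 2)"
      by (intro power_mono) auto
    ultimately show ?thesis
      by (auto intro!: divide_left_mono mult_right_mono)
  qed
  from sums_le[OF this 1 2] have "zeta_real n - 1 \<le> 1 / 2 ^ (n - 2) * (3 / 4)"
    using mult_left_mono[OF pi, of "1 / 2 ^ (n - 2)"] by simp
  also have "1 / 2 ^ (n - 2) * (3 / 4 :: real) = 3 / 2 ^ n"
    using power_diff[of "2::real" 2 n] assms by simp
  finally show ?thesis by simp
qed

lemma zeta_real_tendsto_1: "zeta_real \<longlonglongrightarrow> 1"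
proof (rule tendsto_sandwich)
  show "\<forall>\<^sub>F n in sequentially. 1 \<le> zeta_real n" "\<forall>\<^sub>F n in sequentially. zeta_real n \<le> 1 + 3 / 2 ^ n"
    using zeta_real_ge_1 zeta_real_le by (auto simp: eventually_sequentially)
  have "(\<lambda>n. 1 + 3 * (1 / 2) ^ n) \<longlonglongrightarrow> (1 + 3 * 0 :: real)"
    by (intro tendsto_intros LIMSEQ_power_zero) auto
  thus "(\<lambda>n. 1 + 3 / 2 ^ n) \<longlonglongrightarrow> (1 :: real)" by (simp add: power_divide)
qed auto

lemma lucas_pos: "lucas n > 0"
  by (induction n rule: lucas.induct) auto

lemma lucas_mono_Suc: "n > 0 \<Longrightarrow> lucas n \<le> lucas (Suc n)"
  by (cases n) auto

lemma lucas_mono: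
  assumes "0 < m" "m \<le> n"
  shows "lucas m \<le> lucas n"
  using assms(2,1)
proof (induction rule: dec_induct)
  case (step n)
  thus ?case using lucas_mono_Suc[of n] by linarith
qed auto

text \<open>L_{j+5} = 8 L_j + 5 L_{j-1}, and j + 5 <= 2j.\<close>

lemma lucas_double_ge: "j \<ge> 5 \<Longrightarrow> 8 * lucas j \<le> lucas (2 * j)"
proof -
  assume j: "j \<ge> 5"
  then obtain i where i: "j = Suc i" by (cases j) auto
  have "8 * lucas j \<le> lucas (j + 5)"
    by (simp add: i numeral_eq_Suc)
  also have "\<dots> \<le> lucas (2 * j)" using j by (intro lucas_mono) auto
  finally show ?thesis .
qed

text \<open>The factor 7, just above the limiting ratio 6.854..., leaves one spare L_n to pay for
  the subtracted part of the Lucas weight.\<close>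

lemma lucas_add_4_le: "n \<ge> 4 \<Longrightarrow> lucas (n + 4) \<le> 7 * lucas n"
proof -
  assume "n \<ge> 4"
  then obtain k where "n = k + 4" by (metis add.commute le_Suc_ex)
  thus ?thesis by (simp add: numeral_eq_Suc)
qed

lemma fib_add_2_le: "n > 0 \<Longrightarrow> fib (n + 2) \<le> 3 * fib n"
  using fib_mono[of "n - 1" n] by (cases n) auto

lemma fib_add_4_le: "n > 0 \<Longrightarrow> fib (n + 4) \<le> 8 * fib n"
  using fib_mono[of "n - 1" n] by (cases n) (auto simp: numeral_eq_Suc)

lemma weight_pos: "j \<ge> 2 \<Longrightarrow> weight X j > 0"
proof (cases X)
  case Lucas
  assume "j \<ge> 2"
  have "lucas j < lucas (Suc j)"
    using \<open>j \<ge> 2\<close> lucas_pos[of "j - 1"] by (cases j) auto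
  also have "\<dots> \<le> lucas (2 * j)" using \<open>j \<ge> 2\<close> by (intro lucas_mono) auto
  finally show ?thesis by (simp add: Lucas)
qed (simp add: fib_neq_0_nat add_pos_pos)

lemma weight_nonneg: "weight X j \<ge> 0"
proof -
  consider "j = 0" | "j = 1" | "j \<ge> 2" by linarith
  thus ?thesis
  proof cases
    case 3
    thus ?thesis by (rule less_imp_le[OF weight_pos])
  qed (cases X; simp add: numeral_2_eq_2)+
qed

text \<open>In the Lucas case 8 L_j is absorbed by the slack: L_{2j+4} <= 7 L_{2j} and 8 L_j <=
  L_{2j}, the latter from j = 5 on.\<close>

lemma weight_add_2_le:
  assumes "j \<ge> 5"
  shows "weight X (j + 2) \<le> 8 * weight X j"
proof (cases X)
  case Fibonacci
  have "fib (j + 2) + fib (2 * j + 4) \<le> 8 * fib j + 8 * fib (2 * j)"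
    using assms fib_add_2_le[of j] fib_add_4_le[of "2 * j"] by simp
  moreover have "2 * (j + 2) = 2 * j + 4" by simp
  ultimately show ?thesis
    using of_nat_mono[of "fib (j + 2) + fib (2 * j + 4)" "8 * fib j + 8 * fib (2 * j)", where ?'a = real]
    unfolding Fibonacci weight.simps by (simp only: of_nat_add of_nat_mult of_nat_numeral distrib_left)
next
  case Lucas
  have "lucas (2 * j + 4) + 8 * lucas j \<le> 8 * lucas (2 * j)"
    using assms lucas_double_ge[of j] lucas_add_4_le[of "2 * j"] by simp
  moreover have "2 * (j + 2) = 2 * j + 4" by simp
  moreover from calculation
  have "real (lucas (2 * j + 4)) + 8 * real (lucas j) \<le> 8 * real (lucas (2 * j))"
    using of_nat_mono[of "lucas (2 * j + 4) + 8 * lucas j" "8 * lucas (2 * j)", where ?'a = real]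
    by (simp only: of_nat_add of_nat_mult of_nat_numeral)
  moreover have "a - d \<le> 8 * (b - c)" if "a + 8 * c \<le> 8 * b" "d \<ge> 0" for a b c d :: real
    using that by simp
  ultimately show ?thesis by (simp only: Lucas weight.simps of_nat_0_le_iff)
qed

text \<open>\<open>p_lim\<close> without its common denominator; it reappears in
  \<open>norm_t_term_even\<close>, which ties the finite distributions to the limiting one.\<close>

definition lim_term :: "seq_kind \<Rightarrow> nat \<Rightarrow> real" where
  "lim_term X j = weight X j * pi ^ j / fact j"

lemma lim_term_pos: "j \<ge> 2 \<Longrightarrow> lim_term X j > 0"
  by (simp add: lim_term_def weight_pos)

lemma lim_term_nonneg: "lim_term X j \<ge> 0"
  by (simp add: lim_term_def weight_nonneg)

lemma pi_squared_le: "pi\<^sup>2 \<le> 9.87"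
proof -
  have "pi\<^sup>2 \<le> 3.1416\<^sup>2" using pi_approx by (intro power_mono) auto
  thus ?thesis by (simp add: power2_eq_square)
qed

lemma lim_term_add_2_le:
  assumes "j \<ge> 5"
  shows "lim_term X (j + 2) \<le> 78.96 / (real (j + 1) * real (j + 2)) * lim_term X j"
proof -
  \<comment> \<open>The constant 78.96 of the statement is 8 * 9.87.\<close>
  have "weight X (j + 2) * pi\<^sup>2 \<le> 8 * weight X j * 9.87"
    using weight_add_2_le[OF assms] pi_squared_le weight_nonneg by (intro mult_mono) auto
  hence "weight X (j + 2) * pi\<^sup>2 * (pi ^ j / fact (j + 2)) \<le> 8 * weight X j * 9.87 * (pi ^ j / fact (j + 2))"
    by (intro mult_right_mono) auto
  moreover have "weight X (j + 2) * pi\<^sup>2 * (pi ^ j / fact (j + 2)) = lim_term X (j + 2)"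
    by (simp add: lim_term_def power_add power2_eq_square)
  moreover have "fact (j + 2) = real (j + 1) * real (j + 2) * fact j"
    by (simp add: algebra_simps)
  hence "8 * weight X j * 9.87 * (pi ^ j / fact (j + 2))
           = 78.96 / (real (j + 1) * real (j + 2)) * lim_term X j"
  proof -
    have "8 * w * 9.87 * (p / (a * b * f)) = 78.96 / (a * b) * (w * p / f)" for a b f w p :: real
      by simp
    thus ?thesis unfolding lim_term_def \<open>fact (j + 2) = real (j + 1) * real (j + 2) * fact j\<close> .
  qed
  ultimately show ?thesis by (simp only:)
qed

lemma lim_term_le_of_ratio:
  assumes "j \<ge> 5" "78.96 \<le> c * (real (j + 1) * real (j + 2))"
  shows "lim_term X (j + 2) \<le> c * lim_term X j"
proof -
  have "78.96 / (real (j + 1) * real (j + 2)) \<le> c"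
    using assms(2) by (subst pos_divide_le_eq) auto
  from order_trans[OF lim_term_add_2_le[OF assms(1)] mult_right_mono[OF this lim_term_nonneg]]
  show ?thesis .
qed

lemma lim_term_halves: "j \<ge> 12 \<Longrightarrow> lim_term X (j + 2) \<le> 1 / 2 * lim_term X j"
proof (rule lim_term_le_of_ratio)
  assume j: "j \<ge> 12"
  have "13 * 14 \<le> real (j + 1) * real (j + 2)" using j by (intro mult_mono) auto
  thus "78.96 \<le> 1 / 2 * (real (j + 1) * real (j + 2))" by simp
qed auto

lemma lim_term_10: "lim_term X 10 \<le> 0.88 * lim_term X 8"
  using lim_term_le_of_ratio[of 8 "0.88" X] by simp

text \<open>Two ratio steps reach 12: 78.96/90 < 0.88 and 78.96/132 < 0.6, with 0.88 * 0.6 < 0.53;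
  afterwards the terms at least halve.\<close>

lemma lim_term_ge_12: "even j \<Longrightarrow> j \<ge> 12 \<Longrightarrow> lim_term X j \<le> 0.53 * lim_term X 8"
proof -
  have "lim_term X (12 + 2 * i) \<le> 0.53 * lim_term X 8" for i
  proof (induction i)
    case 0
    show ?case using lim_term_10[of X] lim_term_le_of_ratio[of 10 "0.6" X] lim_term_nonneg[of X 8] by simp
  next
    case (Suc i)
    thus ?case using lim_term_halves[of "12 + 2 * i" X] lim_term_nonneg[of X "12 + 2 * i"]
      by (simp add: algebra_simps)
  qed
  moreover assume "even j" "j \<ge> 12"
  hence "j = 12 + 2 * ((j - 12) div 2)" by auto
  ultimately show ?thesis by metis
qed

section \<open>Explicit weights and the maximum of the limiting terms\<close>

lemma lucas_eq_gen_fib: "lucas n = gen_fib 2 1 n"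
  by (induction n rule: lucas.induct) (simp_all add: gen_fib_recurrence del: gen_fib.simps(3))

lemma gen_fib_Suc: "n > 0 \<Longrightarrow> gen_fib a b (Suc n) = gen_fib b (a + b) n"
  by (cases n) auto

text \<open>Shifting the seeds evaluates an index in linearly many rewrites, where the branching
  recursion would be exponential.\<close>

lemma gen_fib_numeral:
  "gen_fib a b (numeral (Num.Bit0 k)) = gen_fib b (a + b) (numeral (Num.BitM k))"
  "gen_fib a b (numeral (Num.Bit1 k)) = gen_fib b (a + b) (numeral (Num.Bit0 k))"
  "gen_fib a b 1 = b"
  using gen_fib_Suc[of "numeral (Num.BitM k)" a b] gen_fib_Suc[of "numeral (Num.Bit0 k)" a b]
  by (simp_all add: Suc_numeral BitM_plus_one del: gen_fib.simps(3))

lemma weight_values: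
  "weight Fibonacci 2 = 4" "weight Fibonacci 4 = 24" "weight Fibonacci 6 = 152"
  "weight Fibonacci 8 = 1008" "weight Fibonacci 10 = 6820" "weight Fibonacci 12 = 46512"
  "weight Fibonacci 14 = 318188" "weight Fibonacci 16 = 2179296" "weight Fibonacci 18 = 14932936"
  "weight Fibonacci 20 = 102340920" "weight Fibonacci 22 = 701426444"
  "weight Fibonacci 24 = 4807573344" "weight Fibonacci 26 = 32951401492"
  "weight Fibonacci 28 = 225851751528" "weight Fibonacci 30 = 1548009587960"
  "weight Fibonacci 32 = 10610212036032" "weight Lucas 2 = 4" "weight Lucas 4 = 40"
  "weight Lucas 6 = 304" "weight Lucas 8 = 2160" "weight Lucas 10 = 15004"
  "weight Lucas 12 = 103360" "weight Lucas 14 = 709804" "weight Lucas 16 = 4868640"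
  "weight Lucas 18 = 33379504" "weight Lucas 20 = 228811000" "weight Lucas 22 = 1568358004"
  "weight Lucas 24 = 10749853440" "weight Lucas 26 = 73681030804" "weight Lucas 28 = 505018447960"
  "weight Lucas 30 = 3461450947504" "weight Lucas 32 = 23725145626560"
  by (simp_all add: fib_conv_gen_fib lucas_eq_gen_fib gen_fib_numeral del: One_nat_def)

text \<open>Replacing pi^(8-j) by 3^(8-j) already leaves a strict inequality between
  rationals.\<close>

lemma lim_term_less_8:
  assumes "j \<in> {2, 4, 6}"
  shows "lim_term X j < lim_term X 8"
proof -
  have "weight X j / fact j < weight X 8 / fact 8 * 3 ^ (8 - j)"
    using assms by (cases X) (auto simp: weight_values fact_numeral simp del: weight.simps)
  also have "\<dots> \<le> weight X 8 / fact 8 * pi ^ (8 - j)"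
    using pi_gt3 by (intro mult_left_mono power_mono) (auto simp: weight_nonneg)
  finally have "weight X j / fact j * pi ^ j < weight X 8 / fact 8 * pi ^ (8 - j) * pi ^ j"
    by (intro mult_strict_right_mono) auto
  moreover have "pi ^ (8 - j) * pi ^ j = pi ^ 8" using assms by (auto simp flip: power_add)
  ultimately show ?thesis by (simp add: lim_term_def mult.assoc)
qed

lemma lim_term_unique_max:
  assumes "even j" "2 \<le> j" "j \<noteq> 8"
  shows "lim_term X j < lim_term X 8"
proof -
  have "j \<in> {2, 4, 6} \<or> j = 10 \<or> j \<ge> 12" using assms
    unfolding insert_iff empty_iff by presburger
  thus ?thesis
    using lim_term_less_8[of j X] lim_term_10[of X] lim_term_ge_12[of j X] assms lim_term_pos[of 8 X] by auto
qed

section \<open>Term magnitudes\<close>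

text \<open>The zeta argument is -k with k = N - j - 1 even; \<open>j \<le> N - 2\<close> makes k
  positive and so keeps away from zeta(0).\<close>

lemma norm_t_term_odd:
  assumes "even N" "odd j" "j \<le> N - 2" "N \<ge> 2"
  shows "norm (t_term X N j) = 0"
proof -
  define k where "k = N - j - 1"
  have k: "N = j + 1 + k" "j < N" using assms by (auto simp: k_def)
  hence "even k" "k > 0" using assms by auto
  moreover have "of_int (int j + 1 - int N) = (- of_nat k :: complex)" by (simp add: k)
  ultimately show ?thesis
    unfolding t_term_def by (simp only: zeta_neg_even) simp
qed

text \<open>With k = N - j - 1: N binom(N-1, j) k! = N!/j!, and 2^(k+1) / (2 pi)^(k+1) =
  pi^(j-N).\<close>

lemma norm_t_term_even:
  assumes "even N" "even j" "j \<le> N - 2" "N \<ge> 2"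
  shows "norm (t_term X N j) = fact N / pi ^ N * (lim_term X j * zeta_real (N - j))"
proof -
  define k where "k = N - j - 1"
  have k: "N = j + 1 + k" "N - j = Suc k" using assms by (auto simp: k_def)
  have "odd k" using assms k by auto
  have arg: "of_int (int j + 1 - int N) = (- of_nat k :: complex)" by (simp add: k)
  have pos: "zeta_real (Suc k) \<ge> 0"
    using zeta_real_ge_1[of "Suc k"] \<open>odd k\<close> by (cases k) auto
  have "fact j * fact k * real ((N - 1) choose j) = fact (N - 1)"
  proof -
    have "N - 1 - j = k" "j \<le> N - 1" using k by auto
    hence "fact j * fact k * ((N - 1) choose j) = (fact (N - 1) :: nat)"
      using binomial_fact_lemma[of j "N - 1"] by (simp only:)
    thus ?thesis by (metis of_nat_fact of_nat_mult)
  qed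
  moreover have "fact N = real N * fact (N - 1)"
    using k by (intro fact_reduce) auto
  moreover have "x * b * q = x * f / p" if "p * q * b = f" "p \<noteq> 0" for x b q f p :: real
    using that by auto
  ultimately have "real N * real ((N - 1) choose j) * fact k = fact N / fact j"
    by (simp only: fact_nonzero not_False_eq_True)
  moreover have "norm (t_term X N j)
      = real N * real ((N - 1) choose j) * fact k * (weight X j * (2 ^ k * 2) * zeta_real (Suc k) / (2 * pi) ^ Suc k)"
    unfolding t_term_def arg norm_mult norm_zeta_neg_odd[OF \<open>odd k\<close>] k_def[symmetric]
    by (simp add: norm_power weight_nonneg)
  moreover have "weight X j * (2 ^ k * 2) * zeta_real (Suc k) / (2 * pi) ^ Suc k
      = weight X j * pi ^ j * zeta_real (Suc k) / pi ^ N"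
    by (simp add: k power_mult_distrib power_add field_simps)
  ultimately have "norm (t_term X N j) = fact N / fact j * (weight X j * pi ^ j * zeta_real (Suc k) / pi ^ N)"
    by (simp only:)
  thus ?thesis by (simp add: lim_term_def k(2))
qed

text \<open>For j < 8 the zeta factor is at most that of 8. For larger j the decay of
  \<open>lim_term\<close> outweighs it: 0.88 * 1.1 < 1 at j = 10, and 0.53 * 1.75 < 1
  beyond.\<close>

lemma t_term_unique_max:
  assumes "even N" "N \<ge> 26" "j \<in> {1..N-2}" "j \<noteq> 8"
  shows "norm (t_term X N j) < norm (t_term X N 8)"
proof -
  have c: "fact N / pi ^ N > 0" by simp
  have Z: "zeta_real (N - 8) \<ge> 1" using assms by (intro zeta_real_ge_1) auto
  have t8: "norm (t_term X N 8) = fact N / pi ^ N * (lim_term X 8 * zeta_real (N - 8))"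
    using assms by (intro norm_t_term_even) auto
  have w8: "lim_term X 8 > 0" by (rule lim_term_pos) simp
  show ?thesis
  proof (cases "even j")
    case False
    hence "norm (t_term X N j) = 0" using assms by (intro norm_t_term_odd) auto
    also have "\<dots> < norm (t_term X N 8)"
      unfolding t8 using c w8 Z by (intro mult_pos_pos) auto
    finally show ?thesis .
  next
    case True
    have le: "N - j \<ge> 2" using assms by auto
    have tj: "norm (t_term X N j) = fact N / pi ^ N * (lim_term X j * zeta_real (N - j))"
      using assms True by (intro norm_t_term_even) auto
    have ge: "lim_term X 8 \<le> lim_term X 8 * zeta_real (N - 8)"
      using mult_left_mono[OF Z, of "lim_term X 8"] w8 by simp
    have j: "j \<in> {2, 4, 6} \<or> j = 10 \<or> j \<ge> 12"
      using assms True unfolding insert_iff empty_iff atLeastAtMost_iff by presburger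
    have "lim_term X j * zeta_real (N - j) < lim_term X 8 * zeta_real (N - 8)"
    proof -
      consider "j \<in> {2, 4, 6}" | "j = 10" | "j \<ge> 12" using j by blast
      thus ?thesis
      proof cases
        case 1
        have "lim_term X j * zeta_real (N - j) \<le> lim_term X j * zeta_real (N - 8)"
          using 1 assms by (intro mult_left_mono zeta_real_antimono lim_term_nonneg) auto
        also have "\<dots> < lim_term X 8 * zeta_real (N - 8)"
          using lim_term_less_8[OF 1] Z by (intro mult_strict_right_mono) auto
        finally show ?thesis .
      next
        case 2
        have "zeta_real (N - j) \<le> zeta_real 16"
          using 2 assms by (intro zeta_real_antimono) auto
        also have "\<dots> \<le> 1.1" using zeta_real_le[of 16] by simp
        finally have "lim_term X j * zeta_real (N - j) \<le> (0.88 * lim_term X 8) * 1.1"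
          using lim_term_10[of X] 2 w8 zeta_real_ge_1[OF le] by (intro mult_mono) auto
        also have "\<dots> < lim_term X 8" using w8 by simp
        also note ge
        finally show ?thesis .
      next
        case 3
        have "zeta_real (N - j) \<le> zeta_real 2"
          using le by (intro zeta_real_antimono) auto
        also have "\<dots> \<le> 1.75" using zeta_real_le[of 2] by simp
        finally have "lim_term X j * zeta_real (N - j) \<le> (0.53 * lim_term X 8) * 1.75"
          using lim_term_ge_12[OF True 3, of X] w8 zeta_real_ge_1[OF le] by (intro mult_mono) auto
        also have "\<dots> < lim_term X 8" using w8 by simp
        also note ge
        finally show ?thesis .
      qed
    qed
    thus ?thesis unfolding tj t8 using c by (intro mult_strict_left_mono)
  qed
qed

section \<open>The normalising constants and the limits\<close>

text \<open>Used with c = 1 for \<open>D_const\<close> and with c = 4 for the error in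
  \<open>M_total\<close>.\<close>

lemma summable_lim_term:
  assumes "c > 0"
  shows "summable (\<lambda>i. lim_term X (2 * i + 2) * c ^ i)"
proof (rule summable_ratio_test)
  fix i assume i: "max 2 (nat \<lceil>2 * c * 78.96\<rceil>) \<le> i"
  have "2 * c * 78.96 \<le> real i" using i by linarith
  also have "\<dots> \<le> (2 * real i + 3) * 1" by simp
  also have "\<dots> \<le> (2 * real i + 3) * (2 * real i + 4)" by (intro mult_left_mono) auto
  finally have "78.96 \<le> (1 / (2 * c)) * (real (2 * i + 2 + 1) * real (2 * i + 2 + 2))"
    using assms by (simp add: field_simps)
  hence "lim_term X (2 * i + 2 + 2) \<le> 1 / (2 * c) * lim_term X (2 * i + 2)"
    using i by (intro lim_term_le_of_ratio) auto
  from mult_right_mono[OF this, of "c ^ Suc i"]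
  have "lim_term X (2 * Suc i + 2) * c ^ Suc i \<le> 1 / 2 * (lim_term X (2 * i + 2) * c ^ i)"
    using assms by simp
  thus "norm (lim_term X (2 * Suc i + 2) * c ^ Suc i) \<le> 1 / 2 * norm (lim_term X (2 * i + 2) * c ^ i)"
    using assms lim_term_nonneg by (simp add: abs_mult)
qed simp

lemma D_const_sums: "(\<lambda>i. lim_term X (2 * i + 2)) sums D_const X"
proof -
  have summ: "summable (\<lambda>i. lim_term X (2 * i + 2))"
    using summable_lim_term[of 1 X] by simp
  hence "((\<lambda>i. lim_term X (2 * i + 2)) has_sum (\<Sum>i. lim_term X (2 * i + 2))) UNIV"
    using lim_term_nonneg by (intro norm_summable_imp_has_sum) (auto simp: summable_sums)
  moreover have "{j::nat. even j \<and> 2 \<le> j} = range (\<lambda>i. 2 * i + 2)"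
  proof (intro equalityI subsetI)
    fix j :: nat assume "j \<in> {j. even j \<and> 2 \<le> j}"
    hence "j = 2 * ((j - 2) div 2) + 2" unfolding mem_Collect_eq by presburger
    thus "j \<in> range (\<lambda>i. 2 * i + 2)" by blast
  qed auto
  moreover have "inj (\<lambda>i::nat. 2 * i + 2)" by (auto intro: injI)
  ultimately have "(lim_term X has_sum (\<Sum>i. lim_term X (2 * i + 2))) {j. even j \<and> 2 \<le> j}"
    by (simp add: has_sum_reindex o_def)
  hence "D_const X = (\<Sum>i. lim_term X (2 * i + 2))"
    unfolding D_const_def E_gf_def lim_term_def[symmetric] by (rule infsumI)
  thus ?thesis using summ by (simp add: summable_sums)
qed

text \<open>From index 2m + 2 >= 12 the terms at least halve, so the tail is at most twice its first
  term.\<close>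

lemma D_const_bounds:
  assumes "m \<ge> 5"
  shows "(\<Sum>i<m. lim_term X (2 * i + 2)) \<le> D_const X"
    and "D_const X \<le> (\<Sum>i<m. lim_term X (2 * i + 2)) + 2 * lim_term X (2 * m + 2)"
proof -
  have D: "D_const X = (\<Sum>i. lim_term X (2 * i + 2))" and summ: "summable (\<lambda>i. lim_term X (2 * i + 2))"
    using D_const_sums by (auto simp: sums_iff)
  show "(\<Sum>i<m. lim_term X (2 * i + 2)) \<le> D_const X"
    unfolding D by (rule sum_le_suminf[OF summ]) (auto simp: lim_term_nonneg)
  have le: "lim_term X (2 * (i + m) + 2) \<le> (1 / 2) ^ i * lim_term X (2 * m + 2)" for i
  proof (induction i)
    case (Suc i)
    have "lim_term X (2 * (Suc i + m) + 2) \<le> 1 / 2 * lim_term X (2 * (i + m) + 2)"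
      using lim_term_halves[of "2 * (i + m) + 2" X] assms by simp
    with Suc show ?case by simp
  qed simp
  have geo: "(\<lambda>i. (1 / 2) ^ i * lim_term X (2 * m + 2)) sums (2 * lim_term X (2 * m + 2))"
    using sums_mult2[OF geometric_sums[of "1 / 2 :: real"]] by simp
  have "(\<Sum>i. lim_term X (2 * (i + m) + 2)) \<le> 2 * lim_term X (2 * m + 2)"
    using suminf_le[OF le summable_ignore_initial_segment[OF summ] sums_summable[OF geo]] geo
    by (simp add: sums_iff)
  thus "D_const X \<le> (\<Sum>i<m. lim_term X (2 * i + 2)) + 2 * lim_term X (2 * m + 2)"
    unfolding D using suminf_split_initial_segment[OF summ, of m] by simp
qed

lemma D_const_pos: "D_const X > 0"
proof -
  have "0 < (\<Sum>i<5. lim_term X (2 * i + 2))"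
    by (intro sum_pos lim_term_pos) (auto simp: lessThan_empty_iff)
  with D_const_bounds(1)[of 5 X] show ?thesis by simp
qed

lemma M_total_eq:
  "M_total X (2 * n + 2) = fact (2 * n + 2) / pi ^ (2 * n + 2)
     * (\<Sum>i<n. lim_term X (2 * i + 2) * zeta_real (2 * (n - i)))"
proof -
  let ?N = "2 * n + 2"
  have "M_total X ?N = (\<Sum>j\<in>(\<lambda>i. 2 * i + 2) ` {..<n}. norm (t_term X ?N j))"
    unfolding M_total_def
  proof (rule sum.mono_neutral_right)
    show "(\<lambda>i. 2 * i + 2) ` {..<n} \<subseteq> {1..?N - 2}" by auto
    show "\<forall>j\<in>{1..?N - 2} - (\<lambda>i. 2 * i + 2) ` {..<n}. norm (t_term X ?N j) = 0"
    proof
      fix j assume j: "j \<in> {1..?N - 2} - (\<lambda>i. 2 * i + 2) ` {..<n}"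
      have "odd j"
      proof
        assume "even j"
        hence "j = 2 * ((j - 2) div 2) + 2" "(j - 2) div 2 < n" using j by (auto elim: dvdE)
        with j show False by blast
      qed
      thus "norm (t_term X ?N j) = 0" using j by (intro norm_t_term_odd) auto
    qed
  qed simp
  also have "\<dots> = (\<Sum>i<n. norm (t_term X ?N (2 * i + 2)))"
    by (subst sum.reindex) (auto intro: injI simp: inj_on_def)
  also have "\<dots> = (\<Sum>i<n. fact ?N / pi ^ ?N * (lim_term X (2 * i + 2) * zeta_real (2 * (n - i))))"
  proof (rule sum.cong)
    fix i assume "i \<in> {..<n}"
    moreover have "?N - (2 * i + 2) = 2 * (n - i)" by simp
    ultimately show "norm (t_term X ?N (2 * i + 2))
        = fact ?N / pi ^ ?N * (lim_term X (2 * i + 2) * zeta_real (2 * (n - i)))"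
      using norm_t_term_even[of ?N "2 * i + 2" X] by simp
  qed simp
  finally show ?thesis by (simp only: sum_distrib_left)
qed

text \<open>zeta(2(n-i)) exceeds 1 by at most 3 * 4^i / 4^n. Moving 4^i onto the terms leaves a
  convergent series, so the total error is O(4^(-n)).\<close>

lemma M_total_normalised_tendsto:
  "(\<lambda>n. \<Sum>i<n. lim_term X (2 * i + 2) * zeta_real (2 * (n - i))) \<longlonglongrightarrow> D_const X"
proof (rule tendsto_sandwich)
  let ?v = "\<lambda>i. lim_term X (2 * i + 2)"
  let ?C = "\<Sum>i. ?v i * 4 ^ i"
  show "(\<lambda>n. \<Sum>i<n. ?v i) \<longlonglongrightarrow> D_const X"
    using D_const_sums by (simp add: sums_def)
  have "(\<lambda>n. (\<Sum>i<n. ?v i) + 3 * ?C * (1 / 4) ^ n) \<longlonglongrightarrow> D_const X + 3 * ?C * 0"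
    using D_const_sums by (intro tendsto_intros LIMSEQ_power_zero) (auto simp: sums_def)
  thus "(\<lambda>n. (\<Sum>i<n. ?v i) + 3 * ?C * (1 / 4) ^ n) \<longlonglongrightarrow> D_const X" by simp
  show "\<forall>\<^sub>F n in sequentially. (\<Sum>i<n. ?v i) \<le> (\<Sum>i<n. ?v i * zeta_real (2 * (n - i)))"
  proof (intro always_eventually allI sum_mono)
    fix n i :: nat assume "i \<in> {..<n}"
    hence "zeta_real (2 * (n - i)) \<ge> 1" by (intro zeta_real_ge_1) auto
    from mult_left_mono[OF this lim_term_nonneg] show "?v i \<le> ?v i * zeta_real (2 * (n - i))" by simp
  qed
  show "\<forall>\<^sub>F n in sequentially. (\<Sum>i<n. ?v i * zeta_real (2 * (n - i)))
          \<le> (\<Sum>i<n. ?v i) + 3 * ?C * (1 / 4) ^ n"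
  proof (intro always_eventually allI)
    fix n
    have "(\<Sum>i<n. ?v i * zeta_real (2 * (n - i))) \<le> (\<Sum>i<n. ?v i + 3 * (1 / 4) ^ n * (?v i * 4 ^ i))"
    proof (rule sum_mono)
      fix i assume i: "i \<in> {..<n}"
      hence "zeta_real (2 * (n - i)) \<le> 1 + 3 / 2 ^ (2 * (n - i))"
        by (intro zeta_real_le) auto
      also have "(2::real) ^ (2 * (n - i)) = 4 ^ n / 4 ^ i"
        using i power_diff[of "4::real" i n] by (simp add: power_mult)
      finally have "zeta_real (2 * (n - i)) \<le> 1 + 3 * (1 / 4) ^ n * 4 ^ i"
        by (simp add: power_divide)
      from mult_left_mono[OF this lim_term_nonneg[of X "2 * i + 2"]]
      show "?v i * zeta_real (2 * (n - i)) \<le> ?v i + 3 * (1 / 4) ^ n * (?v i * 4 ^ i)"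
        by (simp add: algebra_simps)
    qed
    also have "\<dots> = (\<Sum>i<n. ?v i) + 3 * (1 / 4) ^ n * (\<Sum>i<n. ?v i * 4 ^ i)"
      by (simp only: sum.distrib sum_distrib_left)
    also have "\<dots> \<le> (\<Sum>i<n. ?v i) + 3 * (1 / 4) ^ n * ?C"
      by (intro add_left_mono mult_left_mono sum_le_suminf summable_lim_term)
         (auto simp: lim_term_nonneg)
    finally show "(\<Sum>i<n. ?v i * zeta_real (2 * (n - i))) \<le> (\<Sum>i<n. ?v i) + 3 * ?C * (1 / 4) ^ n"
      by (simp add: mult_ac)
  qed
qed

lemma tendsto_even_at_topI:
  assumes "(\<lambda>n. f (2 * n + 2)) \<longlonglongrightarrow> l"
  shows "(f \<longlongrightarrow> l) even_at_top"
proof (rule topological_tendstoI)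
  fix S assume "open S" "l \<in> S"
  from topological_tendstoD[OF assms this] obtain n0 where n0: "\<And>n. n \<ge> n0 \<Longrightarrow> f (2 * n + 2) \<in> S"
    by (auto simp: eventually_sequentially)
  have "f N \<in> S" if "N \<ge> 2 * n0 + 2" "even N" for N
  proof -
    have "N = 2 * ((N - 2) div 2) + 2" "(N - 2) div 2 \<ge> n0" using that by auto
    thus ?thesis using n0 by metis
  qed
  thus "\<forall>\<^sub>F N in even_at_top. f N \<in> S"
    unfolding eventually_inf_principal eventually_sequentially by blast
qed

lemma zeta_real_shift_tendsto: "(\<lambda>n. zeta_real (2 * n + 2 - 8)) \<longlonglongrightarrow> 1"
\<comment> \<open>Offset 3 turns 2n + 2 - 8 into 2n and avoids truncated subtraction.\<close>
proof (rule LIMSEQ_offset[of _ 3])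
  have "strict_mono (\<lambda>n::nat. 2 * n)" by (auto simp: strict_mono_def)
  from LIMSEQ_subseq_LIMSEQ[OF zeta_real_tendsto_1 this]
  show "(\<lambda>n. zeta_real (2 * (n + 3) + 2 - 8)) \<longlonglongrightarrow> 1" by (simp add: o_def)
qed

lemma p_fin_tendsto: "((\<lambda>N. p_fin X N 8) \<longlongrightarrow> lim_term X 8 / D_const X) even_at_top"
proof (rule tendsto_even_at_topI)
  let ?S = "\<lambda>n. \<Sum>i<n. lim_term X (2 * i + 2) * zeta_real (2 * (n - i))"
  have "(\<lambda>n. lim_term X 8 * zeta_real (2 * n + 2 - 8) / ?S n) \<longlonglongrightarrow> lim_term X 8 * 1 / D_const X"
    using D_const_pos[of X]
    by (intro tendsto_intros zeta_real_shift_tendsto M_total_normalised_tendsto) auto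
  moreover have "\<forall>\<^sub>F n in sequentially.
      lim_term X 8 * zeta_real (2 * n + 2 - 8) / ?S n = p_fin X (2 * n + 2) 8"
    using eventually_ge_at_top[of 4]
  proof eventually_elim
    case (elim n)
    have t8: "norm (t_term X (2 * n + 2) 8)
        = fact (2 * n + 2) / pi ^ (2 * n + 2) * (lim_term X 8 * zeta_real (2 * n + 2 - 8))"
      using elim by (intro norm_t_term_even) auto
    have "(fact (2 * n + 2) / pi ^ (2 * n + 2) :: real) \<noteq> 0" by simp
    from mult_divide_mult_cancel_left[OF this] show ?case
      unfolding p_fin_def M_total_eq t8 using elim by (subst if_P) auto
  qed
  ultimately show "(\<lambda>n. p_fin X (2 * n + 2) 8) \<longlonglongrightarrow> lim_term X 8 / D_const X"
    by (simp add: filterlim_cong)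
qed

lemma Max_t_term:
  assumes "even N" "N \<ge> 26"
  shows "Max ((\<lambda>j. norm (t_term X N j)) ` {1..N-2})
           = fact N / pi ^ N * (lim_term X 8 * zeta_real (N - 8))"
proof -
  have "Max ((\<lambda>j. norm (t_term X N j)) ` {1..N-2}) = norm (t_term X N 8)"
  proof (rule Max_eqI)
    fix y assume "y \<in> (\<lambda>j. norm (t_term X N j)) ` {1..N-2}"
    then obtain j where "j \<in> {1..N-2}" "y = norm (t_term X N j)" by blast
    thus "y \<le> norm (t_term X N 8)"
      using t_term_unique_max[OF assms, of j X] by (cases "j = 8") auto
  qed (use assms in auto)
  thus ?thesis using assms by (simp add: norm_t_term_even)
qed

text \<open>From N = 26 on the quotient of the two sides is exactly zeta(N-8).\<close>

lemma Max_t_term_asymp: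
  "(\<lambda>N. Max ((\<lambda>j. norm (t_term X N j)) ` {1..N-2}))
     \<sim>[even_at_top] (\<lambda>N. lim_term X 8 * (fact N / pi ^ N))"
proof (rule asymp_equivI', rule tendsto_even_at_topI)
  have "\<forall>\<^sub>F n in sequentially. zeta_real (2 * n + 2 - 8) =
      Max ((\<lambda>j. norm (t_term X (2 * n + 2) j)) ` {1..2 * n + 2 - 2})
        / (lim_term X 8 * (fact (2 * n + 2) / pi ^ (2 * n + 2)))"
    using eventually_ge_at_top[of 12]
  proof eventually_elim
    case (elim n)
    have cancel: "z = c * (w * z) / (w * c)" if "c \<noteq> 0" "w \<noteq> 0" for c w z :: real using that by simp
    have "even (2 * n + 2)" "2 * n + 2 \<ge> 26" using elim by auto
    thus ?case
      unfolding Max_t_term[OF \<open>even (2 * n + 2)\<close> \<open>2 * n + 2 \<ge> 26\<close>]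
      using lim_term_pos[of 8 X] by (intro cancel) auto
  qed
  with zeta_real_shift_tendsto
  show "(\<lambda>n. Max ((\<lambda>j. norm (t_term X (2 * n + 2) j)) ` {1..2 * n + 2 - 2})
        / (lim_term X 8 * (fact (2 * n + 2) / pi ^ (2 * n + 2)))) \<longlonglongrightarrow> 1"
    by (rule Lim_transform_eventually)
qed

section \<open>Numerical values of the limiting shares\<close>

text \<open>Entry \<open>i\<close> of each list bounds \<open>pi ^ (2 * i + 2)\<close>; it is obtained from entry \<open>i - 1\<close> by multiplying
  with a bound for \<open>pi\<^sup>2\<close> and rounding outwards to twelve digits.\<close>
definition pi_power_lower :: "real list" where
  "pi_power_lower = [
    9.8696044010, 97.4090910322, 961.389193548, 9488.53101571, 93648.0474716, 924269.181470,
    9122171.18114, 90032220.8360, 888582402.994, 8769956795.24, 86556004182.8, 854273519815,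
    8431341690820, 83214007058000, 821289330284000, 8105800788660000]"

definition pi_power_upper :: "real list" where
  "pi_power_upper = [
    9.8696044011, 97.4090910343, 961.389193580, 9488.53101613, 93648.0474768, 924269.181532,
    9122171.18185, 90032220.8440, 888582403.083, 8769956796.21, 86556004193.4, 854273519929,
    8431341692040, 83214007071000, 821289330422000, 8105800790110000]"

lemma pi_squared_bounds: "9.8696044010 \<le> pi\<^sup>2" "pi\<^sup>2 \<le> 9.8696044011"
proof -
  have "3.141592653588\<^sup>2 \<le> pi\<^sup>2" "pi\<^sup>2 \<le> 3.1415926535899\<^sup>2"
    using pi_approx by (auto intro!: power_mono)
  thus "9.8696044010 \<le> pi\<^sup>2" "pi\<^sup>2 \<le> 9.8696044011"
    by (simp_all add: power2_eq_square)
qed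

lemma pi_power_bounds:
  assumes "i < 16"
  shows "0 \<le> pi_power_lower ! i \<and> pi_power_lower ! i \<le> pi ^ (2 * i + 2) \<and>
         pi ^ (2 * i + 2) \<le> pi_power_upper ! i"
  using assms
proof (induction i)
  case 0
  show ?case using pi_squared_bounds by (simp add: pi_power_lower_def pi_power_upper_def power2_eq_square)
next
  case (Suc i)
  have "\<forall>i\<in>{..<15}. 0 \<le> pi_power_lower ! Suc i \<and>
      pi_power_lower ! Suc i \<le> pi_power_lower ! i * 9.8696044010 \<and>
      pi_power_upper ! i * 9.8696044011 \<le> pi_power_upper ! Suc i"
    unfolding pi_power_lower_def pi_power_upper_def by (simp add: lessThan_nat_numeral)
  hence *: "0 \<le> pi_power_lower ! Suc i" "pi_power_lower ! Suc i \<le> pi_power_lower ! i * 9.8696044010"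
      "pi_power_upper ! i * 9.8696044011 \<le> pi_power_upper ! Suc i"
    using Suc.prems by auto
  have IH: "0 \<le> pi_power_lower ! i" "pi_power_lower ! i \<le> pi ^ (2 * i + 2)"
      "pi ^ (2 * i + 2) \<le> pi_power_upper ! i"
    using Suc by auto
  have step: "pi ^ (2 * Suc i + 2) = pi ^ (2 * i + 2) * pi\<^sup>2"
    by (simp flip: power_add)
  have "pi_power_lower ! Suc i \<le> pi ^ (2 * Suc i + 2)"
    unfolding step using IH pi_squared_bounds by (intro order_trans[OF *(2)] mult_mono) auto
  moreover have "pi ^ (2 * Suc i + 2) \<le> pi_power_upper ! Suc i"
    unfolding step using IH pi_squared_bounds
    by (intro order_trans[OF _ *(3)] mult_mono) (auto intro: order_trans[OF zero_le_power[OF pi_ge_zero]])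
  ultimately show ?case using *(1) by blast
qed

text \<open>Division-free interval test: \<open>D_const\<close> is enclosed by its terms j = 2, ...,
  30 plus twice the term at 32. List entries 3 and 15 belong to pi^8 and pi^32.\<close>

lemma share_bounds:
  fixes X :: seq_kind and c e :: real
  defines "S \<equiv> \<lambda>l. \<Sum>i<15. weight X (2 * i + 2) * l ! i / fact (2 * i + 2)"
  defines "a \<equiv> weight X 8 / fact 8"
  assumes "0 \<le> e" "e \<le> c"
    and up: "a * pi_power_upper ! 3 \<le> (c + e) * S pi_power_lower"
    and low: "(c - e) * (S pi_power_upper + 2 * (weight X 32 * pi_power_upper ! 15 / fact 32))
                \<le> a * pi_power_lower ! 3"
  shows "\<bar>lim_term X 8 / D_const X - c\<bar> \<le> e"
proof -
  have a: "a \<ge> 0" "lim_term X 8 = a * pi ^ 8" by (simp_all add: a_def weight_nonneg lim_term_def)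
  have w8: "a * pi_power_lower ! 3 \<le> lim_term X 8" "lim_term X 8 \<le> a * pi_power_upper ! 3"
    unfolding a(2) using pi_power_bounds[of 3] a(1) by (auto intro!: mult_left_mono)
  have S1: "S pi_power_lower \<le> (\<Sum>i<15. lim_term X (2 * i + 2))"
    unfolding S_def lim_term_def
    by (intro sum_mono divide_right_mono mult_left_mono conjunct1[OF conjunct2[OF pi_power_bounds]])
       (auto simp: weight_nonneg)
  have S2: "(\<Sum>i<15. lim_term X (2 * i + 2)) \<le> S pi_power_upper"
    unfolding S_def lim_term_def
    by (intro sum_mono divide_right_mono mult_left_mono conjunct2[OF conjunct2[OF pi_power_bounds]])
       (auto simp: weight_nonneg)
  have w32: "lim_term X 32 \<le> weight X 32 * pi_power_upper ! 15 / fact 32"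
    unfolding lim_term_def using pi_power_bounds[of 15]
    by (intro divide_right_mono mult_left_mono) (auto simp: weight_nonneg)
  have D: "S pi_power_lower \<le> D_const X"
      "D_const X \<le> S pi_power_upper + 2 * (weight X 32 * pi_power_upper ! 15 / fact 32)"
    using D_const_bounds[of 15 X] S1 S2 w32 by simp_all
  have "lim_term X 8 \<le> (c + e) * D_const X"
    using w8(2) up mult_left_mono[OF D(1), of "c + e"] assms(3,4) by linarith
  moreover have "(c - e) * D_const X \<le> lim_term X 8"
    using w8(1) low mult_left_mono[OF D(2), of "c - e"] assms(4) by linarith
  ultimately have "c - e \<le> lim_term X 8 / D_const X" "lim_term X 8 / D_const X \<le> c + e"
    using D_const_pos[of X] by (simp_all add: pos_le_divide_eq pos_divide_le_eq)
  thus ?thesis by linarith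
qed

lemma lessThan_one: "{..<1::nat} = {0}"
  by auto

lemmas share_eval = lessThan_one numeral_2_eq_2[symmetric] lessThan_nat_numeral weight_values fact_numeral pi_power_lower_def pi_power_upper_def

text \<open>The tolerance is half a unit in the sixth decimal place, so the quoted digits are
  correctly rounded.\<close>

lemma fibonacci_share: "\<bar>lim_term Fibonacci 8 / D_const Fibonacci - 0.273209\<bar> \<le> 5 / 10 ^ 7"
  by (rule share_bounds) (simp_all add: share_eval del: weight.simps One_nat_def)

lemma lucas_share: "\<bar>lim_term Lucas 8 / D_const Lucas - 0.284964\<bar> \<le> 5 / 10 ^ 7"
  by (rule share_bounds) (simp_all add: share_eval del: weight.simps One_nat_def)

theorem proposition7:
  fixes X :: seq_kind
  shows
    "(\<forall>j. even j \<and> 2 \<le> j \<and> j \<noteq> 8 \<longrightarrow> p_lim X j < p_lim X 8) \<and>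
     (\<forall>N. even N \<and> 26 \<le> N \<longrightarrow>
        (\<forall>j\<in>{1..N-2}. j \<noteq> 8 \<longrightarrow> norm (t_term X N j) < norm (t_term X N 8))) \<and>
     (\<lambda>N. Max ((\<lambda>j. norm (t_term X N j)) ` {1..N-2}))
        \<sim>[even_at_top] (\<lambda>N. weight X 8 * pi ^ 8 / fact 8 * (fact N / pi ^ N)) \<and>
     ((\<lambda>N. p_fin X N 8) \<longlongrightarrow> weight X 8 * pi ^ 8 / (fact 8 * D_const X)) even_at_top \<and>
     \<bar>weight Fibonacci 8 * pi ^ 8 / (fact 8 * D_const Fibonacci) - 0.273209\<bar> \<le> 5 / 10 ^ 7 \<and>
     \<bar>weight Lucas 8 * pi ^ 8 / (fact 8 * D_const Lucas) - 0.284964\<bar> \<le> 5 / 10 ^ 7"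
proof -
  have p_lim: "p_lim Y j = lim_term Y j / D_const Y" for Y j
    by (simp add: p_lim_def lim_term_def)
  have share: "weight Y 8 * pi ^ 8 / (fact 8 * D_const Y) = lim_term Y 8 / D_const Y" for Y
    by (simp add: lim_term_def)
  have "p_lim X j < p_lim X 8" if "even j" "2 \<le> j" "j \<noteq> 8" for j
    unfolding p_lim using lim_term_unique_max[OF that] D_const_pos by (rule divide_strict_right_mono)
  moreover have "(\<lambda>N. Max ((\<lambda>j. norm (t_term X N j)) ` {1..N-2}))
        \<sim>[even_at_top] (\<lambda>N. weight X 8 * pi ^ 8 / fact 8 * (fact N / pi ^ N))"
    using Max_t_term_asymp[of X] by (simp only: lim_term_def)
  ultimately show ?thesis
    unfolding share using t_term_unique_max p_fin_tendsto fibonacci_share lucas_share by blast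
qed

end
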